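(* Let $M = G/H$ be a compact normal homogeneous space and let $X$ be a $G$-invariant vector field on $M$. Then $X$ is a Killing field.
   Context: Normal homogeneous space: $M$ is a Riemannian manifold, $G$ is a Lie subgroup of the isometry group $\operatorname{Iso}(M)$ acting transitively on $M$, $H=G_p$ is the isotropy subgroup at a point $p\in M$, and there is a bi-invariant Riemannian metric on $G$ such that the projection $G\to M$, $g\mapsto g\cdot p$, is a Riemannian submersion. A vector field $X$ on $M$ is $G$-invariant if $g_*(X)=X$ for all $g\in G$. *)

theory Defs
  imports "HOL-Analysis.Analysis" "HOL-Algebra.Group_Action"
begin

section \<open>Smooth functions between normed spaces\<close>

text \<open>On an open set of a finite-dimensional space, \<open>C_on k S f\<close> says that \<open>f\<close> is \<open>k\<close> times
  continuously differentiable: total differentiability together with the same property of order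
  \<open>k - 1\<close> for every directional derivative.\<close>

primrec C_on :: "nat \<Rightarrow> 'a::real_normed_vector set \<Rightarrow> ('a \<Rightarrow> 'b::real_normed_vector) \<Rightarrow> bool" where
  "C_on 0 S f \<longleftrightarrow> continuous_on S f"
| "C_on (Suc k) S f \<longleftrightarrow>
     (\<forall>x\<in>S. f differentiable (at x)) \<and> (\<forall>v. C_on k S (\<lambda>x. frechet_derivative f (at x) v))"

definition smooth_on :: "'a::real_normed_vector set \<Rightarrow> ('a \<Rightarrow> 'b::real_normed_vector) \<Rightarrow> bool" where
  "smooth_on S f \<longleftrightarrow> (\<forall>k. C_on k S f)"


section \<open>Smooth manifolds\<close>

text \<open>A chart is a pair of its domain and its coordinate map; the values of the coordinate map
  outside the domain are irrelevant. The atlas need not be maximal.\<close>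

type_synonym ('m, 'e) chart = "'m set \<times> ('m \<Rightarrow> 'e)"

record ('m, 'e) mfd =
  mtop :: "'m topology"
  atlas :: "('m, 'e) chart set"

definition points :: "('m, 'e) mfd \<Rightarrow> 'm set" where
  "points N = topspace (mtop N)"

definition chart_inv :: "('m, 'e) chart \<Rightarrow> 'e \<Rightarrow> 'm" where
  "chart_inv c = inv_into (fst c) (snd c)"

definition chart_image :: "('m, 'e) chart \<Rightarrow> 'e set" where
  "chart_image c = snd c ` fst c"

definition is_chart :: "'m topology \<Rightarrow> ('m, 'e::real_normed_vector) chart \<Rightarrow> bool" where
  "is_chart T c \<longleftrightarrow> openin T (fst c) \<and> open (chart_image c) \<and>
     homeomorphic_map (subtopology T (fst c)) (top_of_set (chart_image c)) (snd c)"

definition transition :: "('m, 'e) chart \<Rightarrow> ('m, 'e) chart \<Rightarrow> 'e \<Rightarrow> 'e" where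
  "transition c d = snd d \<circ> chart_inv c"

text \<open>The model space \<open>'e\<close> is an arbitrary finite-dimensional normed space rather than a
  \<open>euclidean_space\<close>, so that dimension zero is included.\<close>

definition smooth_manifold :: "('m, 'e::real_normed_vector) mfd \<Rightarrow> bool" where
  "smooth_manifold N \<longleftrightarrow>
     (\<exists>B::'e set. finite B \<and> span B = UNIV) \<and>
     Hausdorff_space (mtop N) \<and> second_countable (mtop N) \<and>
     (\<forall>c\<in>atlas N. is_chart (mtop N) c) \<and>
     (\<Union>c\<in>atlas N. fst c) = points N \<and>
     (\<forall>c\<in>atlas N. \<forall>d\<in>atlas N. smooth_on (snd c ` (fst c \<inter> fst d)) (transition c d))"

definition smooth_map ::
  "('m, 'e::real_normed_vector) mfd \<Rightarrow> ('n, 'f::real_normed_vector) mfd \<Rightarrow> ('m \<Rightarrow> 'n) \<Rightarrow> bool" where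
  "smooth_map N P f \<longleftrightarrow> continuous_map (mtop N) (mtop P) f \<and>
     (\<forall>c\<in>atlas N. \<forall>d\<in>atlas P.
        smooth_on (snd c ` {x \<in> fst c. f x \<in> fst d}) (snd d \<circ> f \<circ> chart_inv c))"

definition prod_mfd :: "('m, 'e) mfd \<Rightarrow> ('n, 'f) mfd \<Rightarrow> ('m \<times> 'n, 'e \<times> 'f) mfd" where
  "prod_mfd N P = \<lparr>mtop = prod_topology (mtop N) (mtop P),
     atlas = {(fst c \<times> fst d, map_prod (snd c) (snd d)) |c d. c \<in> atlas N \<and> d \<in> atlas P}\<rparr>"


section \<open>Tangent vectors\<close>

text \<open>A tangent vector at \<open>p\<close> is the family of its coordinate vectors with respect to the charts
  around \<open>p\<close>, subject to the usual transformation law. The value at any other chart is \<open>0\<close>, so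
  that equality of tangent vectors is equality of functions.\<close>

type_synonym ('m, 'e) tvec = "('m, 'e) chart \<Rightarrow> 'e"

definition charts_at :: "('m, 'e) mfd \<Rightarrow> 'm \<Rightarrow> ('m, 'e) chart set" where
  "charts_at N p = {c \<in> atlas N. p \<in> fst c}"

definition tangent_space ::
  "('m, 'e::real_normed_vector) mfd \<Rightarrow> 'm \<Rightarrow> ('m, 'e) tvec set" where
  "tangent_space N p = {v.
     (\<forall>c\<in>charts_at N p. \<forall>d\<in>charts_at N p.
        v d = frechet_derivative (transition c d) (at (snd c p)) (v c)) \<and>
     (\<forall>c. c \<notin> charts_at N p \<longrightarrow> v c = 0)}"

text \<open>The tangent vector at \<open>p\<close> whose coordinate vector in the chart \<open>c\<close> is \<open>u\<close>.\<close>

definition coord_vec ::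
  "('m, 'e::real_normed_vector) mfd \<Rightarrow> ('m, 'e) chart \<Rightarrow> 'm \<Rightarrow> 'e \<Rightarrow> ('m, 'e) tvec" where
  "coord_vec N c p u = (\<lambda>d. if d \<in> charts_at N p
     then frechet_derivative (transition c d) (at (snd c p)) u else 0)"

text \<open>By the chain rule the differential does not depend on the chosen chart \<open>c\<close> around \<open>p\<close>.\<close>

definition differential ::
  "('m, 'e::real_normed_vector) mfd \<Rightarrow> ('n, 'f::real_normed_vector) mfd \<Rightarrow> ('m \<Rightarrow> 'n) \<Rightarrow> 'm
    \<Rightarrow> ('m, 'e) tvec \<Rightarrow> ('n, 'f) tvec" where
  "differential N P f p v = (let c = (SOME c. c \<in> charts_at N p) in
     (\<lambda>d. if d \<in> charts_at P (f p)
        then frechet_derivative (snd d \<circ> f \<circ> chart_inv c) (at (snd c p)) (v c) else 0))"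

definition smooth_vector_field ::
  "('m, 'e::real_normed_vector) mfd \<Rightarrow> ('m \<Rightarrow> ('m, 'e) tvec) \<Rightarrow> bool" where
  "smooth_vector_field N X \<longleftrightarrow>
     (\<forall>p\<in>points N. X p \<in> tangent_space N p) \<and>
     (\<forall>c\<in>atlas N. smooth_on (chart_image c) (\<lambda>x. X (chart_inv c x) c))"

text \<open>For a diffeomorphism \<open>f\<close> of \<open>N\<close> onto itself, \<open>pushforward N f X\<close> is \<open>f\<^sub>* X\<close>.\<close>

definition pushforward ::
  "('m, 'e::real_normed_vector) mfd \<Rightarrow> ('m \<Rightarrow> 'm) \<Rightarrow> ('m \<Rightarrow> ('m, 'e) tvec) \<Rightarrow> 'm \<Rightarrow> ('m, 'e) tvec"
  where
  "pushforward N f X q =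
     (let p = inv_into (points N) f q in differential N N f p (X p))"

definition invariant_vector_field ::
  "('m, 'e::real_normed_vector) mfd \<Rightarrow> ('m \<Rightarrow> 'm) set \<Rightarrow> ('m \<Rightarrow> ('m, 'e) tvec) \<Rightarrow> bool" where
  "invariant_vector_field N G X \<longleftrightarrow> (\<forall>f\<in>G. \<forall>q\<in>points N. pushforward N f X q = X q)"


section \<open>Riemannian metrics\<close>

type_synonym ('m, 'e) metric = "'m \<Rightarrow> ('m, 'e) tvec \<Rightarrow> ('m, 'e) tvec \<Rightarrow> real"

definition metric_in_chart ::
  "('m, 'e::real_normed_vector) mfd \<Rightarrow> ('m, 'e) metric \<Rightarrow> ('m, 'e) chart \<Rightarrow> 'e \<Rightarrow> 'e \<Rightarrow> 'e \<Rightarrow> real"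
  where
  "metric_in_chart N g c x u v = (let p = chart_inv c x in
     g p (coord_vec N c p u) (coord_vec N c p v))"

text \<open>Smoothness is that of \<open>g\<close> as a function on \<open>TN \<oplus> TN\<close>; as \<open>g\<close> is bilinear and the
  dimension is finite, this is the same as smoothness of its components \<open>g\<^sub>i\<^sub>j\<close>.\<close>

definition riemannian_metric ::
  "('m, 'e::real_normed_vector) mfd \<Rightarrow> ('m, 'e) metric \<Rightarrow> bool" where
  "riemannian_metric N g \<longleftrightarrow>
     (\<forall>p\<in>points N.
        (\<forall>v\<in>tangent_space N p. \<forall>w\<in>tangent_space N p. g p v w = g p w v) \<and>
        (\<forall>u\<in>tangent_space N p. \<forall>v\<in>tangent_space N p. \<forall>w\<in>tangent_space N p. \<forall>a b.
           g p (\<lambda>c. a *\<^sub>R u c + b *\<^sub>R v c) w = a * g p u w + b * g p v w) \<and>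
        (\<forall>v\<in>tangent_space N p. v \<noteq> (\<lambda>_. 0) \<longrightarrow> g p v v > 0)) \<and>
     (\<forall>c\<in>atlas N. smooth_on (chart_image c \<times> UNIV \<times> UNIV)
        (\<lambda>(x, u, v). metric_in_chart N g c x u v))"

definition riemannian_manifold ::
  "('m, 'e::real_normed_vector) mfd \<Rightarrow> ('m, 'e) metric \<Rightarrow> bool" where
  "riemannian_manifold N g \<longleftrightarrow> smooth_manifold N \<and> riemannian_metric N g"

definition preserves_metric ::
  "('m, 'e::real_normed_vector) mfd \<Rightarrow> ('m, 'e) metric \<Rightarrow> ('m \<Rightarrow> 'm) \<Rightarrow> bool" where
  "preserves_metric N g f \<longleftrightarrow>
     (\<forall>p\<in>points N. \<forall>v\<in>tangent_space N p. \<forall>w\<in>tangent_space N p.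
        g (f p) (differential N N f p v) (differential N N f p w) = g p v w)"

text \<open>As in \<open>BijGroup\<close>, elements of the isometry group are extensional functions on the points.\<close>

definition isometries ::
  "('m, 'e::real_normed_vector) mfd \<Rightarrow> ('m, 'e) metric \<Rightarrow> ('m \<Rightarrow> 'm) set" where
  "isometries N g = {f \<in> Bij (points N).
     smooth_map N N f \<and> smooth_map N N (inv_into (points N) f) \<and> preserves_metric N g f}"

definition isometry_group ::
  "('m, 'e::real_normed_vector) mfd \<Rightarrow> ('m, 'e) metric \<Rightarrow> ('m \<Rightarrow> 'm) monoid" where
  "isometry_group N g = (BijGroup (points N))\<lparr>carrier := isometries N g\<rparr>"

definition vertical_space ::
  "('m, 'e::real_normed_vector) mfd \<Rightarrow> ('n, 'f::real_normed_vector) mfd \<Rightarrow> ('m \<Rightarrow> 'n) \<Rightarrow> 'm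
    \<Rightarrow> ('m, 'e) tvec set" where
  "vertical_space N P f p = {v \<in> tangent_space N p. differential N P f p v = (\<lambda>_. 0)}"

definition horizontal_space ::
  "('m, 'e::real_normed_vector) mfd \<Rightarrow> ('m, 'e) metric \<Rightarrow> ('n, 'f::real_normed_vector) mfd
    \<Rightarrow> ('m \<Rightarrow> 'n) \<Rightarrow> 'm \<Rightarrow> ('m, 'e) tvec set" where
  "horizontal_space N k P f p =
     {v \<in> tangent_space N p. \<forall>w\<in>vertical_space N P f p. k p v w = 0}"

definition riemannian_submersion ::
  "('m, 'e::real_normed_vector) mfd \<Rightarrow> ('m, 'e) metric
    \<Rightarrow> ('n, 'f::real_normed_vector) mfd \<Rightarrow> ('n, 'f) metric \<Rightarrow> ('m \<Rightarrow> 'n) \<Rightarrow> bool" where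
  "riemannian_submersion N k P g f \<longleftrightarrow> smooth_map N P f \<and>
     (\<forall>p\<in>points N.
        bij_betw (differential N P f p) (horizontal_space N k P f p) (tangent_space P (f p)) \<and>
        (\<forall>v\<in>horizontal_space N k P f p. \<forall>w\<in>horizontal_space N k P f p.
           g (f p) (differential N P f p v) (differential N P f p w) = k p v w))"

text \<open>\<open>killing_field N g X\<close> is the equation \<open>L\<^sub>X g = 0\<close>, where the Lie derivative is written in
  coordinates as
  \<open>(L\<^sub>X g)(u, v) = X(g(u, v)) + g(DX u, v) + g(u, DX v)\<close> for constant \<open>u\<close>, \<open>v\<close>, that is,
  \<open>(L\<^sub>X g)\<^sub>i\<^sub>j = X\<^sup>k \<partial>\<^sub>k g\<^sub>i\<^sub>j + g\<^sub>k\<^sub>j \<partial>\<^sub>i X\<^sup>k + g\<^sub>i\<^sub>k \<partial>\<^sub>j X\<^sup>k\<close>.\<close>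

definition lie_derivative_metric ::
  "('m, 'e::real_normed_vector) mfd \<Rightarrow> ('m, 'e) metric \<Rightarrow> ('m \<Rightarrow> ('m, 'e) tvec)
    \<Rightarrow> ('m, 'e) chart \<Rightarrow> 'e \<Rightarrow> 'e \<Rightarrow> 'e \<Rightarrow> real" where
  "lie_derivative_metric N g X c x u v =
     (let Xc = (\<lambda>y. X (chart_inv c y) c);
          DX = frechet_derivative Xc (at x);
          gc = metric_in_chart N g c
      in frechet_derivative (\<lambda>y. gc y u v) (at x) (Xc x) + gc x (DX u) v + gc x u (DX v))"

definition killing_field ::
  "('m, 'e::real_normed_vector) mfd \<Rightarrow> ('m, 'e) metric \<Rightarrow> ('m \<Rightarrow> ('m, 'e) tvec) \<Rightarrow> bool" where
  "killing_field N g X \<longleftrightarrow> smooth_vector_field N X \<and>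
     (\<forall>c\<in>atlas N. \<forall>x\<in>chart_image c. \<forall>u v. lie_derivative_metric N g X c x u v = 0)"


section \<open>Lie groups and normal homogeneous spaces\<close>

definition lie_group :: "'g monoid \<Rightarrow> ('g, 'f::real_normed_vector) mfd \<Rightarrow> bool" where
  "lie_group K N \<longleftrightarrow> group K \<and> smooth_manifold N \<and> points N = carrier K \<and>
     smooth_map (prod_mfd N N) N (\<lambda>(a, b). a \<otimes>\<^bsub>K\<^esub> b) \<and> smooth_map N N (m_inv K)"

definition bi_invariant_metric ::
  "'g monoid \<Rightarrow> ('g, 'f::real_normed_vector) mfd \<Rightarrow> ('g, 'f) metric \<Rightarrow> bool" where
  "bi_invariant_metric K N k \<longleftrightarrow> riemannian_metric N k \<and>
     (\<forall>a\<in>carrier K. preserves_metric N k (\<lambda>b. a \<otimes>\<^bsub>K\<^esub> b) \<and>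
                    preserves_metric N k (\<lambda>b. b \<otimes>\<^bsub>K\<^esub> a))"

text \<open>The subgroup of the isometry group formed by the points of \<open>L\<close>.\<close>

definition subgroup_of_isometries ::
  "('m, 'e::real_normed_vector) mfd \<Rightarrow> ('m, 'e) metric \<Rightarrow> ('m \<Rightarrow> 'm, 'f) mfd \<Rightarrow> ('m \<Rightarrow> 'm) monoid"
  where
  "subgroup_of_isometries M g L = (isometry_group M g)\<lparr>carrier := points L\<rparr>"

text \<open>\<open>L\<close> is a (not necessarily closed) Lie subgroup of \<open>Iso(M)\<close>: a subgroup with a Lie group
  structure for which the inclusion into \<open>Iso(M)\<close> is smooth. The manifold structure of \<open>Iso(M)\<close> is
  the one given by the Myers-Steenrod theorem, hence the last condition is expressed by
  smoothness of the evaluation \<open>L \<times> M \<rightarrow> M\<close>. An injective smooth homomorphism is automatically an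
  immersion.\<close>

definition lie_subgroup_of_isometries ::
  "('m, 'e::real_normed_vector) mfd \<Rightarrow> ('m, 'e) metric
    \<Rightarrow> ('m \<Rightarrow> 'm, 'f::real_normed_vector) mfd \<Rightarrow> bool" where
  "lie_subgroup_of_isometries M g L \<longleftrightarrow>
     subgroup (points L) (isometry_group M g) \<and>
     lie_group (subgroup_of_isometries M g L) L \<and>
     smooth_map (prod_mfd L M) M (\<lambda>(f, x). f x)"

text \<open>\<open>M = G/H\<close>, where \<open>G\<close> is the Lie group with underlying manifold \<open>L\<close> and \<open>H\<close> is the isotropy
  group at \<open>p\<close>.\<close>

definition normal_homogeneous_space ::
  "('m, 'e::real_normed_vector) mfd \<Rightarrow> ('m, 'e) metric
    \<Rightarrow> ('m \<Rightarrow> 'm, 'f::real_normed_vector) mfd \<Rightarrow> ('m \<Rightarrow> 'm) set \<Rightarrow> 'm \<Rightarrow> bool" where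
  "normal_homogeneous_space M g L H p \<longleftrightarrow>
     riemannian_manifold M g \<and>
     lie_subgroup_of_isometries M g L \<and>
     transitive_action (subgroup_of_isometries M g L) (points M) (\<lambda>f. f) \<and>
     p \<in> points M \<and>
     H = stabilizer (subgroup_of_isometries M g L) (\<lambda>f. f) p \<and>
     (\<exists>k. bi_invariant_metric (subgroup_of_isometries M g L) L k \<and>
          riemannian_submersion L k M g (\<lambda>f. f p))"

end

theory Submission
  imports Defs
begin

text \<open>
  Let \<open>\<pi> : G \<rightarrow> M\<close>, \<open>\<pi>(f) = f p\<close>. Fix \<open>q = a p\<close> and \<open>u \<in> T\<^sub>qM\<close>, choose a horizontal
  \<open>\<eta> \<in> T\<^sub>aG\<close> over \<open>u\<close> and a curve \<open>\<gamma>\<close> in \<open>G\<close> through the identity with \<open>d\<pi>(\<gamma>'(0)) = X\<^sub>p\<close>.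
  For a curve \<open>\<alpha>\<close> with \<open>\<alpha>(0) = a\<close>, \<open>\<alpha>'(0) = \<eta>\<close> put \<open>\<Phi>(s, t) = \<alpha>(s) \<gamma>(t) p\<close>. Invariance of \<open>X\<close>
  means \<open>\<partial>\<^sub>t \<Phi>(s, 0) = X(\<Phi>(s, 0))\<close>, so by the symmetry of second derivatives \<open>(L\<^sub>X g)(u, u)\<close> is
  the derivative at \<open>t = 0\<close> of the squared length of \<open>\<partial>\<^sub>s \<Phi>(0, t)\<close>. This vector is \<open>d\<pi>\<close> of the
  right translate of \<open>\<eta>\<close> by \<open>\<gamma>(t)\<close>, which has the length of \<open>\<eta>\<close>, and \<open>d\<pi>\<close> does not increase
  lengths; as \<open>\<eta>\<close> is horizontal, there is equality at \<open>t = 0\<close>. Hence the squared length has a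
  maximum at \<open>0\<close> and its derivative vanishes.
\<close>

section \<open>Symmetry of second derivatives\<close>

lemma vector_derivative_bound:
  fixes \<phi> :: "real \<Rightarrow> 'a::real_normed_vector"
  assumes "0 \<le> r"
    and "\<And>t. 0 \<le> t \<Longrightarrow> t \<le> r \<Longrightarrow> (\<phi> has_vector_derivative \<phi>' t) (at t)"
    and "\<And>t. 0 \<le> t \<Longrightarrow> t \<le> r \<Longrightarrow> norm (\<phi>' t) \<le> B"
  shows "norm (\<phi> r - \<phi> 0) \<le> B * r"
proof -
  have "norm (\<phi> r - \<phi> 0) \<le> B * norm (r - 0)"
  proof (rule differentiable_bound[where S = "{0..r}" and f' = "\<lambda>t h. h *\<^sub>R \<phi>' t"])
    fix t assume "t \<in> {0..r}"
    then have t: "0 \<le> t" "t \<le> r" by auto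
    show "(\<phi> has_derivative (\<lambda>h. h *\<^sub>R \<phi>' t)) (at t within {0..r})"
      using assms(2)[OF t] has_derivative_at_withinI unfolding has_vector_derivative_def by blast
    show "onorm (\<lambda>h. h *\<^sub>R \<phi>' t) \<le> B"
      using assms(3)[OF t] by (intro onorm_le) (simp add: mult.commute[of B] mult_left_mono)
  qed (use assms(1) in auto)
  then show ?thesis using assms(1) by simp
qed

lemma has_vector_derivative_along_line:
  assumes "f differentiable (at (x + t *\<^sub>R v))"
  shows "((\<lambda>t. f (x + t *\<^sub>R v)) has_vector_derivative frechet_derivative f (at (x + t *\<^sub>R v)) v) (at t)"
proof -
  have D: "(f has_derivative frechet_derivative f (at (x + t *\<^sub>R v))) (at (x + t *\<^sub>R v))"
    using assms by (simp add: frechet_derivative_works)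
  have "((\<lambda>t. x + t *\<^sub>R v) has_derivative (\<lambda>h. h *\<^sub>R v)) (at t)"
    by (auto intro!: derivative_eq_intros)
  from has_derivative_compose[OF this D] show ?thesis
    unfolding has_vector_derivative_def
    using linear_scale[OF has_derivative_linear[OF D]] by simp
qed

text \<open>The mean value inequality is used twice: along \<open>v\<close> for the difference of
  two values of \<open>f\<close> offset by \<open>r *\<^sub>R w\<close>, and along \<open>w\<close>
  for the derivative of that difference.\<close>

lemma second_difference_bound:
  fixes f :: "'a::real_normed_vector \<Rightarrow> 'b::real_normed_vector"
  assumes r: "0 \<le> r"
    and sub: "\<And>s t. 0 \<le> s \<Longrightarrow> s \<le> r \<Longrightarrow> 0 \<le> t \<Longrightarrow> t \<le> r \<Longrightarrow> x + s *\<^sub>R v + t *\<^sub>R w \<in> S"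
    and f: "\<And>y. y \<in> S \<Longrightarrow> f differentiable (at y)"
    and f': "\<And>y. y \<in> S \<Longrightarrow> (\<lambda>y. frechet_derivative f (at y) v) differentiable (at y)"
    and C: "\<And>y. y \<in> S \<Longrightarrow>
      norm (frechet_derivative (\<lambda>y. frechet_derivative f (at y) v) (at y) w - C) \<le> e"
  shows "norm (f (x + r *\<^sub>R v + r *\<^sub>R w) - f (x + r *\<^sub>R v) - f (x + r *\<^sub>R w) + f x - (r * r) *\<^sub>R C)
    \<le> e * r * r"
proof -
  let ?f' = "\<lambda>y. frechet_derivative f (at y) v"
  \<comment> \<open>The linear correction makes \<open>?\<phi> r - ?\<phi> 0\<close> the second
    difference minus \<open>(r * r) *\<^sub>R C\<close>.\<close>
  let ?\<phi> = "\<lambda>s. f (x + r *\<^sub>R w + s *\<^sub>R v) - f (x + s *\<^sub>R v) - s *\<^sub>R r *\<^sub>R C"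
  let ?\<phi>' = "\<lambda>s. ?f' (x + r *\<^sub>R w + s *\<^sub>R v) - ?f' (x + s *\<^sub>R v) - r *\<^sub>R C"
  have mem: "x + s *\<^sub>R v + t *\<^sub>R w \<in> S" "x + t *\<^sub>R w + s *\<^sub>R v \<in> S"
    if "0 \<le> s" "s \<le> r" "0 \<le> t" "t \<le> r" for s t
    using sub[OF that] by (simp_all add: algebra_simps)
  have bound: "norm (?\<phi>' s) \<le> e * r" if s: "0 \<le> s" "s \<le> r" for s
  proof -
    let ?\<psi> = "\<lambda>t. ?f' (x + s *\<^sub>R v + t *\<^sub>R w) - t *\<^sub>R C"
    have "norm (?\<psi> r - ?\<psi> 0) \<le> e * r"
    proof (rule vector_derivative_bound[OF r])
      fix t :: real assume t: "0 \<le> t" "t \<le> r"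
      show "(?\<psi> has_vector_derivative
          (frechet_derivative ?f' (at (x + s *\<^sub>R v + t *\<^sub>R w)) w - C)) (at t)"
        by (rule derivative_eq_intros has_vector_derivative_along_line f' mem(1) s t | simp)+
      show "norm (frechet_derivative ?f' (at (x + s *\<^sub>R v + t *\<^sub>R w)) w - C) \<le> e"
        by (rule C, rule mem(1)[OF s t])
    qed
    then show ?thesis by (simp add: algebra_simps)
  qed
  have "norm (?\<phi> r - ?\<phi> 0) \<le> e * r * r"
  proof (rule vector_derivative_bound[OF r])
    fix s :: real assume s: "0 \<le> s" "s \<le> r"
    have 1: "x + r *\<^sub>R w + s *\<^sub>R v \<in> S" "x + s *\<^sub>R v \<in> S"
      using mem(2)[OF s, of r] mem(2)[OF s, of 0] r by auto
    show "(?\<phi> has_vector_derivative ?\<phi>' s) (at s)"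
      by (rule derivative_eq_intros has_vector_derivative_along_line f 1 | simp)+
  qed (rule bound)
  then show ?thesis by (simp add: algebra_simps)
qed

text \<open>The second difference is unchanged when \<open>v\<close> and \<open>w\<close> are
  exchanged, and for small \<open>r\<close> it is within \<open>e * r * r\<close> of
  \<open>r * r\<close> times either mixed derivative. Later this exchanges differentiation in the
  group with differentiation in the manifold.\<close>

lemma symmetric_second_derivative:
  fixes f :: "'a::real_normed_vector \<Rightarrow> 'b::real_normed_vector"
  assumes S: "open S" "x \<in> S" and f: "C_on 2 S f"
  shows "frechet_derivative (\<lambda>y. frechet_derivative f (at y) v) (at x) w =
    frechet_derivative (\<lambda>y. frechet_derivative f (at y) w) (at x) v"
proof -
  let ?D = "\<lambda>v w y. frechet_derivative (\<lambda>y. frechet_derivative f (at y) v) (at y) w"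
  have d1: "f differentiable (at y)" if "y \<in> S" for y
    using f that by (simp add: numeral_2_eq_2)
  have d2: "(\<lambda>y. frechet_derivative f (at y) v) differentiable (at y)" if "y \<in> S" for y v
    using f that by (simp add: numeral_2_eq_2)
  have cont: "continuous_on S (?D v w)" for v w
    using f by (simp add: numeral_2_eq_2)
  have "norm (?D v w x - ?D w v x) \<le> 2 * e" if "e > 0" for e
  proof -
    have near: "\<exists>d>0. \<forall>y\<in>ball x d. y \<in> S \<and> norm (?D v w y - ?D v w x) \<le> e" for v w
    proof -
      have "eventually (\<lambda>y. dist (?D v w y) (?D v w x) < e) (at x)"
        using cont[of v w] S \<open>e > 0\<close> by (auto simp: continuous_on_eq_continuous_at isCont_def tendsto_iff)
      moreover have "eventually (\<lambda>y. y \<in> S) (at x)"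
        using S by (auto simp: eventually_at_topological)
      ultimately have "eventually (\<lambda>y. y \<in> S \<and> norm (?D v w y - ?D v w x) \<le> e) (at x)"
        by eventually_elim (simp add: dist_norm)
      then obtain d where "d > 0" "\<forall>y. y \<noteq> x \<and> dist y x < d \<longrightarrow> y \<in> S \<and> norm (?D v w y - ?D v w x) \<le> e"
        by (auto simp: eventually_at)
      \<comment> \<open>The filter \<open>at x\<close> leaves out \<open>x\<close> itself, where the
        bound is trivial.\<close>
      then show ?thesis using S(2) \<open>e > 0\<close>
        by (intro exI[of _ d]) (auto simp: dist_commute, metis less_eq_real_def norm_zero right_minus_eq)
    qed
    obtain d1 d2 where d: "d1 > 0" "d2 > 0"
      "\<forall>y\<in>ball x d1. y \<in> S \<and> norm (?D v w y - ?D v w x) \<le> e"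
      "\<forall>y\<in>ball x d2. y \<in> S \<and> norm (?D w v y - ?D w v x) \<le> e"
      using near[of v w] near[of w v] by blast
    define d where "d = min d1 d2"
    \<comment> \<open>With this \<open>r\<close> the parallelogram spanned at \<open>x\<close> by
      \<open>r *\<^sub>R v\<close> and \<open>r *\<^sub>R w\<close> stays in the ball; the summand 1
      keeps the denominator positive when both vectors vanish.\<close>
    define r where "r = d / (2 * (norm v + norm w + 1))"
    have n: "norm v + norm w + 1 > 0" by (simp add: add_nonneg_pos)
    then have r: "r > 0" using d unfolding r_def d_def by simp
    have rd: "r * (norm v + norm w) < d"
    proof -
      have "r * (norm v + norm w) \<le> r * (norm v + norm w + 1)" using r by simp
      also have "\<dots> = d / 2" unfolding r_def using n by (simp add: field_simps)
      also have "\<dots> < d" using d unfolding d_def by linarith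
      finally show ?thesis .
    qed
    have mem: "x + s *\<^sub>R v + t *\<^sub>R w \<in> ball x d" if "0 \<le> s" "s \<le> r" "0 \<le> t" "t \<le> r" for s t
    proof -
      have "norm (s *\<^sub>R v + t *\<^sub>R w) \<le> s * norm v + t * norm w"
        using that by (metis abs_of_nonneg norm_scaleR norm_triangle_ineq)
      also have "\<dots> \<le> r * norm v + r * norm w" using that by (intro add_mono mult_right_mono) auto
      finally have "norm (s *\<^sub>R v + t *\<^sub>R w) < d" using rd by (simp add: algebra_simps)
      then show ?thesis by (metis add.assoc add_diff_cancel_left' dist_commute dist_norm mem_ball)
    qed
    let ?\<Delta> = "f (x + r *\<^sub>R v + r *\<^sub>R w) - f (x + r *\<^sub>R v) - f (x + r *\<^sub>R w) + f x"
    have 1: "norm (?\<Delta> - (r * r) *\<^sub>R ?D v w x) \<le> e * r * r"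
      using d d1 d2 mem r by (intro second_difference_bound[where S = "ball x d"]) (auto simp: d_def)
    have mem': "x + s *\<^sub>R w + t *\<^sub>R v \<in> ball x d" if "0 \<le> s" "s \<le> r" "0 \<le> t" "t \<le> r" for s t
      using mem[of t s] that by (metis add.commute add.left_commute)
    have "norm (f (x + r *\<^sub>R w + r *\<^sub>R v) - f (x + r *\<^sub>R w) - f (x + r *\<^sub>R v) + f x - (r * r) *\<^sub>R ?D w v x)
        \<le> e * r * r"
      using d d1 d2 mem' r by (intro second_difference_bound[where S = "ball x d"]) (auto simp: d_def)
    moreover have "f (x + r *\<^sub>R w + r *\<^sub>R v) - f (x + r *\<^sub>R w) - f (x + r *\<^sub>R v) + f x = ?\<Delta>"
      by (simp add: algebra_simps)
    ultimately have 2: "norm (?\<Delta> - (r * r) *\<^sub>R ?D w v x) \<le> e * r * r" by simp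
    have "(r * r) * norm (?D v w x - ?D w v x) = norm ((r * r) *\<^sub>R (?D v w x - ?D w v x))"
      using r by simp
    also have "(r * r) *\<^sub>R (?D v w x - ?D w v x) =
        (?\<Delta> - (r * r) *\<^sub>R ?D w v x) - (?\<Delta> - (r * r) *\<^sub>R ?D v w x)"
      by (simp add: scaleR_diff_right)
    also have "norm \<dots> \<le> e * r * r + e * r * r"
      by (rule order.trans[OF norm_triangle_ineq4 add_mono[OF 2 1]])
    also have "\<dots> = (r * r) * (2 * e)" by simp
    finally show ?thesis using r by simp
  qed
  \<comment> \<open>A positive norm would be bounded by half of itself.\<close>
  from this[of "norm (?D v w x - ?D w v x) / 4"] show ?thesis by fastforce
qed

text \<open>Since \<open>linear\<close> does not include boundedness, differentiability is assumed,
  and the value of the derivative is read off along lines. This yields the derivative of the metric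
  in its vector arguments.\<close>

lemma has_derivative_linear_unique:
  assumes "linear f" "(f has_derivative f') (at x)"
  shows "f' = f"
proof
  fix v
  have "f differentiable (at (x + 0 *\<^sub>R v))" using assms(2) by (auto simp: differentiable_def)
  from has_vector_derivative_along_line[OF this]
  have "((\<lambda>t. f (x + t *\<^sub>R v)) has_vector_derivative f' v) (at 0)"
    using frechet_derivative_at[OF assms(2)] by simp
  moreover have "((\<lambda>t. f x + t *\<^sub>R f v) has_vector_derivative f v) (at 0)"
    by (auto intro!: derivative_eq_intros)
  then have "((\<lambda>t. f (x + t *\<^sub>R v)) has_vector_derivative f v) (at 0)"
    using assms(1) by (simp add: linear_add linear_scale)
  ultimately show "f' v = f v" by (rule vector_derivative_unique_at)
qed

section \<open>Charts\<close>

text \<open>Injectivity of the coordinate map forces the inverse supplied by the homeomorphism to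
  agree with \<open>chart_inv\<close> on the chart image.\<close>

lemma is_chart_homeomorphic_maps:
  assumes "is_chart T c"
  shows "homeomorphic_maps (subtopology T (fst c)) (top_of_set (chart_image c)) (snd c) (chart_inv c)"
proof -
  have sub: "fst c \<subseteq> topspace T" and hom: "homeomorphic_map (subtopology T (fst c)) (top_of_set (chart_image c)) (snd c)"
    using assms openin_subset by (auto simp: is_chart_def)
  from hom obtain g where g: "homeomorphic_maps (subtopology T (fst c)) (top_of_set (chart_image c)) (snd c) g"
    by (auto simp: homeomorphic_map_maps)
  have inj: "inj_on (snd c) (fst c)"
    using hom sub by (simp add: homeomorphic_map_def Int_absorb1)
  have "g y = chart_inv c y" if "y \<in> chart_image c" for y
    using that inj g sub unfolding chart_image_def chart_inv_def
    by (auto simp: homeomorphic_maps_def topspace_subtopology_subset)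
  then show ?thesis
    by (intro homeomorphic_maps_eq[OF g]) auto
qed

lemma chart_inv_apply [simp]:
  assumes "is_chart T c" "x \<in> fst c"
  shows "chart_inv c (snd c x) = x"
  using is_chart_homeomorphic_maps[OF assms(1)] assms openin_subset[of T "fst c"]
  by (auto simp: homeomorphic_maps_def is_chart_def)

lemma chart_apply_inv:
  assumes "y \<in> chart_image c"
  shows "snd c (chart_inv c y) = y" "chart_inv c y \<in> fst c"
  using assms by (auto simp: chart_image_def chart_inv_def f_inv_into_f inv_into_into)

lemma open_chart_image_of_open:
  assumes c: "is_chart T c" and U: "openin T U"
  shows "open (snd c ` (fst c \<inter> U))"
proof -
  have "openin (subtopology T (fst c)) (fst c \<inter> U)"
    using U by (metis inf_commute openin_subtopology_Int)
  then have "openin (top_of_set (chart_image c)) (snd c ` (fst c \<inter> U))"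
    using c homeomorphic_imp_open_map unfolding is_chart_def open_map_def by blast
  then show ?thesis using c by (auto simp: is_chart_def dest: openin_open_trans)
qed

text \<open>A coordinate expression of \<open>f\<close> is meaningful only on this set. Its openness
  allows derivatives to be transferred between functions that agree there.\<close>

lemma open_coordinate_domain:
  assumes "is_chart T c" "continuous_map T U f" "is_chart U d"
  shows "open (snd c ` {x \<in> fst c. f x \<in> fst d})"
proof -
  have "openin T {x \<in> fst c. f x \<in> fst d}"
    using assms by (intro openin_continuous_map_preimage_gen[OF assms(2)]) (auto simp: is_chart_def)
  from open_chart_image_of_open[OF assms(1) this] show ?thesis
    by (simp add: Int_absorb1 Collect_mono_iff subset_iff)
qed

lemma is_chart_prod:
  assumes c: "is_chart T c" and d: "is_chart U d"
  shows "is_chart (prod_topology T U) (fst c \<times> fst d, map_prod (snd c) (snd d))"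
proof -
  have im: "chart_image (fst c \<times> fst d, map_prod (snd c) (snd d)) = chart_image c \<times> chart_image d"
    by (auto simp: chart_image_def)
  have "homeomorphic_maps (prod_topology (subtopology T (fst c)) (subtopology U (fst d)))
    (prod_topology (top_of_set (chart_image c)) (top_of_set (chart_image d)))
    (\<lambda>(x,y). (snd c x, snd d y)) (\<lambda>(x,y). (chart_inv c x, chart_inv d y))"
    using is_chart_homeomorphic_maps[OF c] is_chart_homeomorphic_maps[OF d]
    unfolding homeomorphic_maps_prod by blast
  moreover have "(\<lambda>(x,y). (snd c x, snd d y)) = map_prod (snd c) (snd d)" by auto
  ultimately show "is_chart (prod_topology T U) (fst c \<times> fst d, map_prod (snd c) (snd d))"
    using c d unfolding is_chart_def im
    by (simp add: openin_prod_Times_iff open_Times subtopology_Times homeomorphic_maps_map)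
qed

lemma chart_inv_prod:
  assumes c: "is_chart T c" and d: "is_chart U d" and "y \<in> chart_image c" "z \<in> chart_image d"
  shows "chart_inv (fst c \<times> fst d, map_prod (snd c) (snd d)) (y, z) = (chart_inv c y, chart_inv d z)"
  using chart_inv_apply[OF is_chart_prod[OF c d], of "(chart_inv c y, chart_inv d z)"]
    chart_apply_inv[OF assms(3)] chart_apply_inv[OF assms(4)] by simp

lemma smooth_manifoldD:
  assumes "smooth_manifold N"
  shows "c \<in> atlas N \<Longrightarrow> is_chart (mtop N) c"
    and "c \<in> atlas N \<Longrightarrow> x \<in> fst c \<Longrightarrow> x \<in> points N"
    and "x \<in> points N \<Longrightarrow> \<exists>c. c \<in> charts_at N x"
  using assms unfolding smooth_manifold_def charts_at_def by blast+

lemma smooth_on_imp_differentiable: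
  "smooth_on S f \<Longrightarrow> x \<in> S \<Longrightarrow> f differentiable (at x)"
  unfolding smooth_on_def by (metis C_on.simps(2))

section \<open>Differentiable maps and tangent vectors\<close>

text \<open>A weakening of \<open>smooth_map\<close> that suffices for the chain rule and for
  differentials. It is easier to verify for slices such as the right translations of a Lie
  group.\<close>

definition differentiable_map ::
  "('m, 'e::real_normed_vector) mfd \<Rightarrow> ('n, 'f::real_normed_vector) mfd \<Rightarrow> ('m \<Rightarrow> 'n) \<Rightarrow> bool" where
  "differentiable_map N P f \<longleftrightarrow> continuous_map (mtop N) (mtop P) f \<and>
     (\<forall>c\<in>atlas N. \<forall>d\<in>atlas P. \<forall>x\<in>fst c. f x \<in> fst d \<longrightarrow>
        (snd d \<circ> f \<circ> chart_inv c) differentiable (at (snd c x)))"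

lemma smooth_map_imp_differentiable_map:
  "smooth_map N P f \<Longrightarrow> differentiable_map N P f"
  unfolding smooth_map_def differentiable_map_def
  by (auto intro!: smooth_on_imp_differentiable)

lemma differentiable_map_in_points:
  "differentiable_map N P f \<Longrightarrow> x \<in> points N \<Longrightarrow> f x \<in> points P"
  by (auto simp: differentiable_map_def continuous_map_def points_def)

lemma differentiable_mapD:
  assumes "differentiable_map N P f" "c \<in> charts_at N x" "d \<in> charts_at P (f x)"
  shows "((snd d \<circ> f \<circ> chart_inv c) has_derivative
    frechet_derivative (snd d \<circ> f \<circ> chart_inv c) (at (snd c x))) (at (snd c x))"
  using assms by (auto simp: differentiable_map_def charts_at_def frechet_derivative_works)

text \<open>The coordinate expressions of the identity are the transition maps, so every change of
  chart below becomes an instance of the chain rule.\<close>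

lemma differentiable_map_id:
  assumes "smooth_manifold N"
  shows "differentiable_map N N id"
  using assms unfolding differentiable_map_def smooth_manifold_def
  by (auto simp: transition_def continuous_map_id intro!: smooth_on_imp_differentiable)

text \<open>Passing through the chart \<open>d\<close> gives the same function only where
  \<open>f\<close> takes values in the domain of \<open>d\<close>, which is open in coordinates and
  contains the point.\<close>

lemma coordinate_chain_rule:
  assumes N: "smooth_manifold N" and P: "smooth_manifold P"
    and f: "differentiable_map N P f" and h: "differentiable_map P Q h"
    and c: "c \<in> charts_at N x" and d: "d \<in> charts_at P (f x)" and e: "e \<in> charts_at Q (h (f x))"
  shows "((snd e \<circ> (h \<circ> f) \<circ> chart_inv c) has_derivative
     (\<lambda>u. frechet_derivative (snd e \<circ> h \<circ> chart_inv d) (at (snd d (f x)))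
       (frechet_derivative (snd d \<circ> f \<circ> chart_inv c) (at (snd c x)) u))) (at (snd c x))"
proof -
  have charts: "is_chart (mtop N) c" "is_chart (mtop P) d" "x \<in> fst c" "f x \<in> fst d"
    using c d smooth_manifoldD(1)[OF N] smooth_manifoldD(1)[OF P] by (auto simp: charts_at_def)
  have 1: "(snd d \<circ> f \<circ> chart_inv c) (snd c x) = snd d (f x)"
    using charts by simp
  have "((\<lambda>y. (snd e \<circ> h \<circ> chart_inv d) ((snd d \<circ> f \<circ> chart_inv c) y)) has_derivative
     (\<lambda>u. frechet_derivative (snd e \<circ> h \<circ> chart_inv d) (at (snd d (f x)))
       (frechet_derivative (snd d \<circ> f \<circ> chart_inv c) (at (snd c x)) u))) (at (snd c x))"
    by (rule has_derivative_compose[OF differentiable_mapD[OF f c d]])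
       (unfold 1, rule differentiable_mapD[OF h d e])
  then show ?thesis
  proof (rule has_derivative_transform_within_open)
    show "open (snd c ` {x \<in> fst c. f x \<in> fst d})"
      using f charts by (intro open_coordinate_domain) (auto simp: differentiable_map_def)
  qed (use charts in auto)
qed

lemma frechet_coordinate_chain_rule:
  assumes "smooth_manifold N" "smooth_manifold P"
    and "differentiable_map N P f" "differentiable_map P Q h"
    and "c \<in> charts_at N x" "d \<in> charts_at P (f x)" "e \<in> charts_at Q (h (f x))"
  shows "frechet_derivative (snd e \<circ> (h \<circ> f) \<circ> chart_inv c) (at (snd c x)) u =
     frechet_derivative (snd e \<circ> h \<circ> chart_inv d) (at (snd d (f x)))
       (frechet_derivative (snd d \<circ> f \<circ> chart_inv c) (at (snd c x)) u)"
  using frechet_derivative_at[OF coordinate_chain_rule[OF assms]] by metis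

section \<open>Differentials and tangent vectors in arbitrary charts\<close>

lemma transition_eq: "transition c d = snd d \<circ> id \<circ> chart_inv c"
  by (simp add: transition_def)

text \<open>The definition uses a chart picked by \<open>SOME\<close>. The transformation law of
  \<open>v\<close> and the chain rule for \<open>f\<close> after the identity replace it by
  \<open>c\<close>.\<close>

lemma differential_apply:
  assumes N: "smooth_manifold N" and f: "differentiable_map N P f"
    and v: "v \<in> tangent_space N x" and c: "c \<in> charts_at N x" and d: "d \<in> charts_at P (f x)"
  shows "differential N P f x v d = frechet_derivative (snd d \<circ> f \<circ> chart_inv c) (at (snd c x)) (v c)"
proof -
  define c0 where "c0 = (SOME c. c \<in> charts_at N x)"
  have c0: "c0 \<in> charts_at N x" unfolding c0_def using c by (rule someI)
  have "v c = frechet_derivative (snd c \<circ> id \<circ> chart_inv c0) (at (snd c0 x)) (v c0)"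
    using v c c0 unfolding tangent_space_def transition_eq by blast
  with frechet_coordinate_chain_rule[OF N N differentiable_map_id[OF N] f c0, of c d "v c0"] c d
  show ?thesis by (simp add: differential_def Let_def flip: c0_def)
qed

lemma differential_in_tangent_space:
  assumes N: "smooth_manifold N" and P: "smooth_manifold P" and f: "differentiable_map N P f"
    and v: "v \<in> tangent_space N x" and x: "x \<in> points N"
  shows "differential N P f x v \<in> tangent_space P (f x)"
proof -
  obtain c where c: "c \<in> charts_at N x" using smooth_manifoldD(3)[OF N x] by blast
  have "differential N P f x v e = frechet_derivative (transition d e) (at (snd d (f x))) (differential N P f x v d)"
    if "d \<in> charts_at P (f x)" "e \<in> charts_at P (f x)" for d e
    unfolding differential_apply[OF N f v c that(1)] differential_apply[OF N f v c that(2)] transition_eq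
    using frechet_coordinate_chain_rule[OF N P f differentiable_map_id[OF P] c that(1), of e "v c"] that(2)
    by simp
  moreover have "differential N P f x v e = 0" if "e \<notin> charts_at P (f x)" for e
    using that by (simp add: differential_def Let_def)
  ultimately show ?thesis
    unfolding tangent_space_def by blast
qed

lemma coord_vec_in_tangent_space:
  assumes N: "smooth_manifold N" and c: "c \<in> charts_at N x"
  shows "coord_vec N c x u \<in> tangent_space N x"
proof -
  have "coord_vec N c x u e = frechet_derivative (transition d e) (at (snd d x)) (coord_vec N c x u d)"
    if "d \<in> charts_at N x" "e \<in> charts_at N x" for d e
    using frechet_coordinate_chain_rule[OF N N differentiable_map_id[OF N] differentiable_map_id[OF N] c,
        of d e u] that
    by (simp add: coord_vec_def transition_eq)
  moreover have "coord_vec N c x u e = 0" if "e \<notin> charts_at N x" for e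
    using that by (simp add: coord_vec_def)
  ultimately show ?thesis
    unfolding tangent_space_def by blast
qed

text \<open>\<open>transition c c\<close> is the identity on the chart image, an open neighbourhood
  of the point in question.\<close>

lemma coord_vec_self:
  assumes N: "smooth_manifold N" and c: "c \<in> charts_at N x"
  shows "coord_vec N c x u c = u"
proof -
  have c': "is_chart (mtop N) c" "x \<in> fst c"
    using c smooth_manifoldD(1)[OF N] by (auto simp: charts_at_def)
  have "(transition c c has_derivative (\<lambda>u. u)) (at (snd c x))"
    by (rule has_derivative_transform_within_open[where f = "\<lambda>y. y" and s = "chart_image c"])
       (use c' in \<open>auto simp: is_chart_def chart_image_def transition_def chart_apply_inv\<close>)
  from frechet_derivative_at[OF this, symmetric] show ?thesis
    using c by (simp add: coord_vec_def)
qed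

lemma coord_vec_of_tangent:
  assumes "v \<in> tangent_space N x" "c \<in> charts_at N x"
  shows "coord_vec N c x (v c) = v"
proof
  fix d
  have "v d = frechet_derivative (transition c d) (at (snd c x)) (v c)" if "d \<in> charts_at N x"
    using assms that unfolding tangent_space_def by blast
  moreover have "v d = 0" if "d \<notin> charts_at N x"
    using assms that unfolding tangent_space_def by blast
  ultimately show "coord_vec N c x (v c) d = v d"
    unfolding coord_vec_def by presburger
qed

lemma coord_vec_linear:
  assumes N: "smooth_manifold N" and c: "c \<in> charts_at N x"
  shows "coord_vec N c x (a *\<^sub>R u + b *\<^sub>R v) =
    (\<lambda>d. a *\<^sub>R coord_vec N c x u d + b *\<^sub>R coord_vec N c x v d)"
proof
  fix d
  show "coord_vec N c x (a *\<^sub>R u + b *\<^sub>R v) d = a *\<^sub>R coord_vec N c x u d + b *\<^sub>R coord_vec N c x v d"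
  proof (cases "d \<in> charts_at N x")
    case True
    then show ?thesis
      using has_derivative_linear[OF differentiable_mapD[OF differentiable_map_id[OF N] c, of d]]
      by (simp add: coord_vec_def transition_eq linear_add linear_scale)
  qed (simp add: coord_vec_def)
qed

lemma tangent_space_linear:
  assumes N: "smooth_manifold N" and v: "v \<in> tangent_space N x" and w: "w \<in> tangent_space N x"
    and x: "x \<in> points N"
  shows "(\<lambda>c. a *\<^sub>R v c + b *\<^sub>R w c) \<in> tangent_space N x"
proof -
  obtain c where c: "c \<in> charts_at N x" using smooth_manifoldD(3)[OF N x] by blast
  show ?thesis
    using coord_vec_in_tangent_space[OF N c] coord_vec_linear[OF N c, of a "v c" b "w c"]
    unfolding coord_vec_of_tangent[OF v c] coord_vec_of_tangent[OF w c] by metis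
qed

lemma differential_linear:
  assumes N: "smooth_manifold N" and P: "smooth_manifold P" and f: "differentiable_map N P f"
    and v: "v \<in> tangent_space N x" and w: "w \<in> tangent_space N x" and x: "x \<in> points N"
  shows "differential N P f x (\<lambda>c. a *\<^sub>R v c + b *\<^sub>R w c) =
    (\<lambda>d. a *\<^sub>R differential N P f x v d + b *\<^sub>R differential N P f x w d)"
proof
  fix d
  obtain c where c: "c \<in> charts_at N x" using smooth_manifoldD(3)[OF N x] by blast
  show "differential N P f x (\<lambda>c. a *\<^sub>R v c + b *\<^sub>R w c) d =
    a *\<^sub>R differential N P f x v d + b *\<^sub>R differential N P f x w d"
  proof (cases "d \<in> charts_at P (f x)")
    case True
    show ?thesis
      using has_derivative_linear[OF differentiable_mapD[OF f c True]]
      by (simp add: differential_apply[OF N f _ c True] v w tangent_space_linear[OF N v w x]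
          linear_add linear_scale)
  qed (simp add: differential_def Let_def)
qed

section \<open>Partial derivatives in product charts\<close>

lemma coordinate_slice_fst:
  assumes c: "is_chart T c" and d: "is_chart U d" and x: "x \<in> fst c" and y: "y \<in> fst d"
    and D: "(\<phi> \<circ> chart_inv (fst c \<times> fst d, map_prod (snd c) (snd d)) has_derivative D) (at (snd c x, snd d y))"
  shows "((\<lambda>s. \<phi> (chart_inv c s, y)) has_derivative (\<lambda>h. D (h, 0))) (at (snd c x))"
proof -
  have "((\<lambda>s. (s, snd d y)) has_derivative (\<lambda>h. (h, 0))) (at (snd c x))"
    by (auto intro!: derivative_eq_intros)
  from has_derivative_compose[OF this D] show ?thesis
    by (rule has_derivative_transform_within_open[where s = "chart_image c"])
       (use assms in \<open>auto simp: chart_inv_prod[OF c d] chart_image_def is_chart_def\<close>)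
qed

lemma coordinate_slice_snd:
  assumes c: "is_chart T c" and d: "is_chart U d" and x: "x \<in> fst c" and y: "y \<in> fst d"
    and D: "(\<phi> \<circ> chart_inv (fst c \<times> fst d, map_prod (snd c) (snd d)) has_derivative D) (at (snd c x, snd d y))"
  shows "((\<lambda>s. \<phi> (x, chart_inv d s)) has_derivative (\<lambda>h. D (0, h))) (at (snd d y))"
proof -
  have "((\<lambda>s. (snd c x, s)) has_derivative (\<lambda>h. (0, h))) (at (snd d y))"
    by (auto intro!: derivative_eq_intros)
  from has_derivative_compose[OF this D] show ?thesis
    by (rule has_derivative_transform_within_open[where s = "chart_image d"])
       (use assms in \<open>auto simp: chart_inv_prod[OF c d] chart_image_def is_chart_def\<close>)
qed

lemma prod_chart_in_atlas:
  assumes "c \<in> atlas N" "d \<in> atlas P"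
  shows "(fst c \<times> fst d, map_prod (snd c) (snd d)) \<in> atlas (prod_mfd N P)"
proof -
  have "\<exists>c' d'. (fst c \<times> fst d, map_prod (snd c) (snd d)) = (fst c' \<times> fst d', map_prod (snd c') (snd d')) \<and>
      c' \<in> atlas N \<and> d' \<in> atlas P"
    by (rule exI[of _ c], rule exI[of _ d]) (intro conjI refl assms)
  then show ?thesis unfolding prod_mfd_def mfd.simps mem_Collect_eq .
qed

text \<open>In a product chart around \<open>(x, y)\<close> the slice is the restriction of a
  differentiable function to an affine subspace. Applied to the multiplication, this gives
  differentiability of right translations.\<close>

lemma differentiable_map_slice:
  assumes N: "smooth_manifold N" and P: "smooth_manifold P"
    and f: "smooth_map (prod_mfd N P) Q f" and y: "y \<in> points P"
  shows "differentiable_map N Q (\<lambda>x. f (x, y))"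
  unfolding differentiable_map_def
proof (intro conjI ballI impI)
  have "continuous_map (mtop N) (prod_topology (mtop N) (mtop P)) (\<lambda>x. (x, y))"
    using y by (intro continuous_map_pairedI) (auto simp: points_def)
  moreover have "continuous_map (prod_topology (mtop N) (mtop P)) (mtop Q) f"
    using f by (simp add: smooth_map_def prod_mfd_def)
  ultimately have "continuous_map (mtop N) (mtop Q) (f \<circ> (\<lambda>x. (x, y)))"
    by (rule continuous_map_compose)
  then show "continuous_map (mtop N) (mtop Q) (\<lambda>x. f (x, y))" by (simp add: o_def)
next
  fix c e x assume c: "c \<in> atlas N" and e: "e \<in> atlas Q" and x: "x \<in> fst c" and fx: "f (x, y) \<in> fst e"
  obtain d where d: "d \<in> atlas P" "y \<in> fst d"
    using smooth_manifoldD(3)[OF P y] by (auto simp: charts_at_def)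
  let ?B = "(fst c \<times> fst d, map_prod (snd c) (snd d))"
  have B: "?B \<in> charts_at (prod_mfd N P) (x, y)"
    using prod_chart_in_atlas[OF c d(1)] d(2) x by (simp add: charts_at_def)
  have "((snd e \<circ> f \<circ> chart_inv ?B) has_derivative
      frechet_derivative (snd e \<circ> f \<circ> chart_inv ?B) (at (snd c x, snd d y))) (at (snd c x, snd d y))"
    using differentiable_mapD[OF smooth_map_imp_differentiable_map[OF f] B, of e] e fx
    by (simp add: charts_at_def)
  from coordinate_slice_fst[OF smooth_manifoldD(1)[OF N c] smooth_manifoldD(1)[OF P d(1)] x d(2) this]
  show "(snd e \<circ> (\<lambda>x. f (x, y)) \<circ> chart_inv c) differentiable (at (snd c x))"
    by (auto simp: differentiable_def o_def)
qed

section \<open>Riemannian metrics and Killing fields\<close>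

lemma metric_symmetric:
  "riemannian_metric N g \<Longrightarrow> x \<in> points N \<Longrightarrow> v \<in> tangent_space N x \<Longrightarrow> w \<in> tangent_space N x \<Longrightarrow>
    g x v w = g x w v"
  by (simp add: riemannian_metric_def)

lemma metric_linear:
  "riemannian_metric N g \<Longrightarrow> x \<in> points N \<Longrightarrow> u \<in> tangent_space N x \<Longrightarrow> v \<in> tangent_space N x \<Longrightarrow>
    w \<in> tangent_space N x \<Longrightarrow> g x (\<lambda>c. a *\<^sub>R u c + b *\<^sub>R v c) w = a * g x u w + b * g x v w"
  unfolding riemannian_metric_def by blast

lemma metric_nonneg:
  assumes N: "smooth_manifold N" and g: "riemannian_metric N g"
    and x: "x \<in> points N" and v: "v \<in> tangent_space N x"
  shows "g x v v \<ge> 0"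
proof (cases "v = (\<lambda>_. 0)")
  case True
  then show ?thesis using metric_linear[OF g x v v v, of 0 0] by simp
next
  case False
  then show ?thesis using g x v by (auto simp: riemannian_metric_def intro: less_imp_le)
qed

lemma riemannian_submersion_isometric:
  "riemannian_submersion N k P g f \<Longrightarrow> x \<in> points N \<Longrightarrow>
    v \<in> horizontal_space N k P f x \<Longrightarrow> w \<in> horizontal_space N k P f x \<Longrightarrow>
    g (f x) (differential N P f x v) (differential N P f x w) = k x v w"
  unfolding riemannian_submersion_def by blast

text \<open>Split \<open>v\<close> into the horizontal vector \<open>h\<close> with the same image
  and the vertical rest \<open>w\<close>. The two are orthogonal, so dropping \<open>w\<close> can
  only decrease the squared length, and on \<open>h\<close> the differential is isometric.\<close>

lemma riemannian_submersion_norm_le: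
  assumes N: "smooth_manifold N" and P: "smooth_manifold P" and k: "riemannian_metric N k"
    and sub: "riemannian_submersion N k P g f"
    and x: "x \<in> points N" and v: "v \<in> tangent_space N x"
  shows "g (f x) (differential N P f x v) (differential N P f x v) \<le> k x v v"
proof -
  let ?D = "differential N P f x"
  have f: "differentiable_map N P f"
    using sub by (simp add: riemannian_submersion_def smooth_map_imp_differentiable_map)
  have "?D v \<in> ?D ` horizontal_space N k P f x"
    using sub x differential_in_tangent_space[OF N P f v x]
    by (auto simp: riemannian_submersion_def bij_betw_def)
  then obtain h where h: "h \<in> horizontal_space N k P f x" and Dh: "?D v = ?D h" by blast
  have hT: "h \<in> tangent_space N x" using h by (simp add: horizontal_space_def)
  define w where "w = (\<lambda>c. 1 *\<^sub>R v c + (-1) *\<^sub>R h c)"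
  have wT: "w \<in> tangent_space N x"
    unfolding w_def by (rule tangent_space_linear[OF N v hT x])
  have "?D w = (\<lambda>_. 0)"
    unfolding w_def differential_linear[OF N P f v hT x] Dh by simp
  then have hw: "k x h w = 0"
    using h wT by (simp add: horizontal_space_def vertical_space_def)
  have v_eq: "v = (\<lambda>c. 1 *\<^sub>R h c + 1 *\<^sub>R w c)" by (simp add: w_def)
  have "k x v v = k x h v + k x w v"
    using metric_linear[OF k x hT wT v, of 1 1] v_eq by simp
  also have "k x h v = k x h h + k x w h"
    using metric_linear[OF k x hT wT hT, of 1 1] v_eq metric_symmetric[OF k x hT v] by simp
  also have "k x w v = k x h w + k x w w"
    using metric_linear[OF k x hT wT wT, of 1 1] v_eq metric_symmetric[OF k x wT v] by simp
  finally have "k x v v = k x h h + k x w w"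
    using hw metric_symmetric[OF k x hT wT] by simp
  moreover have "g (f x) (?D v) (?D v) = k x h h"
    unfolding Dh by (rule riemannian_submersion_isometric[OF sub x h h])
  ultimately show ?thesis using metric_nonneg[OF N k x wT] by simp
qed

section \<open>The metric in a fixed chart\<close>

context
  fixes N :: "('m, 'e::real_normed_vector) mfd" and g c x
  assumes N: "riemannian_manifold N g" and c: "c \<in> atlas N" and x: "x \<in> chart_image c"
begin

lemma metric_in_chart_symmetric: "metric_in_chart N g c x u v = metric_in_chart N g c x v u"
  and metric_in_chart_linear: "linear (\<lambda>u. metric_in_chart N g c x u v)"
proof -
  have N': "smooth_manifold N" "riemannian_metric N g" using N by (auto simp: riemannian_manifold_def)
  have cx: "c \<in> charts_at N (chart_inv c x)" "chart_inv c x \<in> points N"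
    using c chart_apply_inv(2)[OF x] smooth_manifoldD(2)[OF N'(1) c] by (auto simp: charts_at_def)
  note T = coord_vec_in_tangent_space[OF N'(1) cx(1)]
  show "metric_in_chart N g c x u v = metric_in_chart N g c x v u"
    unfolding metric_in_chart_def Let_def by (rule metric_symmetric[OF N'(2) cx(2) T T])
  have *: "metric_in_chart N g c x (a *\<^sub>R u + b *\<^sub>R w) v =
      a * metric_in_chart N g c x u v + b * metric_in_chart N g c x w v" for a b u w
    unfolding metric_in_chart_def Let_def coord_vec_linear[OF N'(1) cx(1)]
    by (rule metric_linear[OF N'(2) cx(2) T T T])
  show "linear (\<lambda>u. metric_in_chart N g c x u v)"
  proof (rule linearI)
    show "metric_in_chart N g c x (u + w) v = metric_in_chart N g c x u v + metric_in_chart N g c x w v" for u w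
      using *[of 1 u 1 w] by simp
    show "metric_in_chart N g c x (a *\<^sub>R u) v = a *\<^sub>R metric_in_chart N g c x u v" for a u
      using *[of a u 0 0] by simp
  qed
qed

lemma metric_in_chart_differentiable:
  "(\<lambda>(y, u, v). metric_in_chart N g c y u v) differentiable (at (x, u, v))"
  using N c x by (auto simp: riemannian_manifold_def riemannian_metric_def intro!: smooth_on_imp_differentiable)

lemma metric_in_chart_base_differentiable:
  "((\<lambda>y. metric_in_chart N g c y u v) has_derivative
    (\<lambda>h. frechet_derivative (\<lambda>(y, u, v). metric_in_chart N g c y u v) (at (x, u, v)) (h, 0, 0))) (at x)"
proof -
  have "((\<lambda>y. (y, u, v)) has_derivative (\<lambda>h. (h, 0, 0))) (at x)"
    by (intro has_derivative_Pair has_derivative_const has_derivative_ident)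
  from has_derivative_compose[OF this metric_in_chart_differentiable[unfolded frechet_derivative_works]]
  show ?thesis by simp
qed

text \<open>The total derivative is a sum over the three arguments, and in each vector argument the
  metric is linear, hence its own derivative. For \<open>h\<close> the value of \<open>X\<close> and
  \<open>w\<close> its derivative along \<open>u\<close>, the right-hand side is the Lie derivative
  on \<open>(u, u)\<close>.\<close>

lemma metric_in_chart_derivative:
  "frechet_derivative (\<lambda>(y, u, v). metric_in_chart N g c y u v) (at (x, u, u)) (h, w, w) =
    frechet_derivative (\<lambda>y. metric_in_chart N g c y u u) (at x) h +
    metric_in_chart N g c x w u + metric_in_chart N g c x u w"
proof -
  let ?G = "\<lambda>(y, u, v). metric_in_chart N g c y u v"
  let ?D = "frechet_derivative ?G (at (x, u, u))"
  have D: "(?G has_derivative ?D) (at (x, u, u))"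
    using metric_in_chart_differentiable by (simp add: frechet_derivative_works)
  have "?D (h, w, w) = ?D ((h, 0, 0) + (0, w, 0) + (0, 0, w))" by simp
  also have "\<dots> = ?D (h, 0, 0) + ?D (0, w, 0) + ?D (0, 0, w)"
    by (simp only: linear_add[OF has_derivative_linear[OF D]])
  also have "?D (h, 0, 0) = frechet_derivative (\<lambda>y. metric_in_chart N g c y u u) (at x) h"
    using fun_cong[OF frechet_derivative_at[OF metric_in_chart_base_differentiable]] .
  also have "?D (0, w, 0) = metric_in_chart N g c x w u"
  proof -
    have "((\<lambda>w. (x, w, u)) has_derivative (\<lambda>w. (0, w, 0))) (at u)"
      by (auto intro!: derivative_eq_intros)
    from has_derivative_compose[OF this D]
    have "((\<lambda>w. metric_in_chart N g c x w u) has_derivative (\<lambda>w. ?D (0, w, 0))) (at u)" by simp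
    from fun_cong[OF has_derivative_linear_unique[OF metric_in_chart_linear this]] show ?thesis .
  qed
  \<comment> \<open>Linearity was proved in the first vector argument; symmetry carries it over to
    the second.\<close>
  also have "?D (0, 0, w) = metric_in_chart N g c x u w"
  proof -
    have "((\<lambda>w. (x, u, w)) has_derivative (\<lambda>w. (0, 0, w))) (at u)"
      by (auto intro!: derivative_eq_intros)
    from has_derivative_compose[OF this D]
    have "((\<lambda>w. metric_in_chart N g c x w u) has_derivative (\<lambda>w. ?D (0, 0, w))) (at u)"
      by (simp add: metric_in_chart_symmetric[of u])
    from fun_cong[OF has_derivative_linear_unique[OF metric_in_chart_linear this]]
    show ?thesis by (simp add: metric_in_chart_symmetric[of u])
  qed
  finally show ?thesis .
qed

end

text \<open>Polarization: in coordinates the Lie derivative of the metric is symmetric and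
  biadditive in \<open>u\<close> and \<open>v\<close>, so it is determined by its values on the
  diagonal.\<close>

lemma killing_field_diagonalI:
  assumes N: "riemannian_manifold N g" and X: "smooth_vector_field N X"
    and diag: "\<And>c x u. c \<in> atlas N \<Longrightarrow> x \<in> chart_image c \<Longrightarrow> lie_derivative_metric N g X c x u u = 0"
  shows "killing_field N g X"
  unfolding killing_field_def
proof (intro conjI X ballI allI)
  fix c x u v assume c: "c \<in> atlas N" and x: "x \<in> chart_image c"
  let ?G = "metric_in_chart N g c" and ?X = "\<lambda>y. X (chart_inv c y) c"
  let ?A = "\<lambda>u v. frechet_derivative (\<lambda>y. ?G y u v) (at x) (?X x)"
  let ?B = "\<lambda>u. frechet_derivative ?X (at x) u"
  have lie: "lie_derivative_metric N g X c x u v = ?A u v + ?G x (?B u) v + ?G x u (?B v)" for u v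
    by (simp add: lie_derivative_metric_def Let_def)
  have "?X differentiable (at x)"
    using X c x by (auto simp: smooth_vector_field_def intro: smooth_on_imp_differentiable)
  then have B: "?B (u + v) = ?B u + ?B v"
    by (intro linear_add linear_frechet_derivative)
  have opn: "open (chart_image c)"
    using N c by (auto simp: riemannian_manifold_def smooth_manifold_def is_chart_def)
  have sym: "?G y u v = ?G y v u" if "y \<in> chart_image c" for y u v
    by (rule metric_in_chart_symmetric[OF N c that])
  have add1: "?G y (u + v) w = ?G y u w + ?G y v w" if "y \<in> chart_image c" for y u v w
    by (rule linear_add[OF metric_in_chart_linear[OF N c that]])
  have add2: "?G y w (u + v) = ?G y w u + ?G y w v" if "y \<in> chart_image c" for y u v w
    using add1[OF that] sym[OF that] by metis
  have dG: "((\<lambda>y. ?G y u v) has_derivative frechet_derivative (\<lambda>y. ?G y u v) (at x)) (at x)" for u v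
    using metric_in_chart_base_differentiable[OF N c x] frechet_derivative_works by (metis differentiable_def)
  have "((\<lambda>y. ?G y u u + ?G y u v + (?G y u v + ?G y v v)) has_derivative
      (\<lambda>h. frechet_derivative (\<lambda>y. ?G y u u) (at x) h + frechet_derivative (\<lambda>y. ?G y u v) (at x) h +
        (frechet_derivative (\<lambda>y. ?G y u v) (at x) h + frechet_derivative (\<lambda>y. ?G y v v) (at x) h))) (at x)"
    by (intro has_derivative_add dG)
  then have "((\<lambda>y. ?G y (u + v) (u + v)) has_derivative
      (\<lambda>h. frechet_derivative (\<lambda>y. ?G y u u) (at x) h + frechet_derivative (\<lambda>y. ?G y u v) (at x) h +
        (frechet_derivative (\<lambda>y. ?G y u v) (at x) h + frechet_derivative (\<lambda>y. ?G y v v) (at x) h))) (at x)"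
    by (rule has_derivative_transform_within_open[OF _ opn x]) (simp add: add1 add2 sym[of _ v u])
  from fun_cong[OF frechet_derivative_at[OF this], of "?X x"]
  have A: "?A (u + v) (u + v) = ?A u u + ?A u v + (?A u v + ?A v v)" by simp
  have "lie_derivative_metric N g X c x (u + v) (u + v) =
    lie_derivative_metric N g X c x u u + 2 * lie_derivative_metric N g X c x u v +
    lie_derivative_metric N g X c x v v"
    unfolding lie A B by (simp add: add1[OF x] add2[OF x] sym[OF x, of v] sym[OF x, of "?B v" u])
  then show "lie_derivative_metric N g X c x u v = 0"
    using diag[OF c x] by simp
qed

section \<open>Invariant fields on normal homogeneous spaces\<close>

lemma smooth_on_imp_derivative_differentiable:
  "smooth_on S f \<Longrightarrow> x \<in> S \<Longrightarrow> (\<lambda>y. frechet_derivative f (at y) v) differentiable (at x)"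
  unfolding smooth_on_def by (metis C_on.simps(2))

lemma subgroup_of_isometriesD:
  assumes L: "lie_subgroup_of_isometries M g L" and a: "a \<in> points L"
  shows "smooth_map M M a" "bij_betw a (points M) (points M)"
    and "b \<in> points L \<Longrightarrow> x \<in> points M \<Longrightarrow> (a \<otimes>\<^bsub>subgroup_of_isometries M g L\<^esub> b) x = a (b x)"
proof -
  have iso: "points L \<subseteq> isometries M g"
    using L subgroup.subset by (fastforce simp: lie_subgroup_of_isometries_def isometry_group_def)
  then show "smooth_map M M a" "bij_betw a (points M) (points M)"
    using a by (auto simp: isometries_def Bij_def)
  show "(a \<otimes>\<^bsub>subgroup_of_isometries M g L\<^esub> b) x = a (b x)" if "b \<in> points L" "x \<in> points M"
    using iso a that
    by (auto simp: subgroup_of_isometries_def isometry_group_def BijGroup_def isometries_def compose_def)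
qed

text \<open>\<open>pushforward\<close> at \<open>f x\<close> selects a preimage by
  \<open>inv_into\<close>, and injectivity of \<open>f\<close> makes it \<open>x\<close>.\<close>

lemma invariant_vector_field_differential:
  assumes X: "invariant_vector_field M G X" and f: "f \<in> G" "bij_betw f (points M) (points M)"
    and x: "x \<in> points M"
  shows "differential M M f x (X x) = X (f x)"
proof -
  have "inv_into (points M) f (f x) = x" "f x \<in> points M"
    using f(2) x by (auto simp: bij_betw_def)
  with X f(1) show ?thesis
    unfolding invariant_vector_field_def pushforward_def Let_def by metis
qed

text \<open>The argument sketched at the start, in coordinates. The curve \<alpha> is not
  constructed: differentiation in \<open>s\<close> becomes the partial derivative of the evaluation
  map in the group variable, in the direction of \<eta>.\<close>

lemma lie_derivative_metric_diagonal:
  assumes norm: "normal_homogeneous_space M g L H p"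
    and X: "smooth_vector_field M X" and inv: "invariant_vector_field M (points L) X"
    and c: "c \<in> atlas M" and x: "x \<in> chart_image c"
  shows "lie_derivative_metric M g X c x u u = 0"
proof -
  let ?K = "subgroup_of_isometries M g L"
  have R: "riemannian_manifold M g" and L: "lie_subgroup_of_isometries M g L"
    and p: "p \<in> points M"
    using norm by (auto simp: normal_homogeneous_space_def)
  have M: "smooth_manifold M" and g: "riemannian_metric M g"
    using R by (auto simp: riemannian_manifold_def)
  have K: "group ?K" and LM: "smooth_manifold L" and carrier: "carrier ?K = points L"
    and mult: "smooth_map (prod_mfd L L) L (\<lambda>(a, b). a \<otimes>\<^bsub>?K\<^esub> b)"
    and eval: "smooth_map (prod_mfd L M) M (\<lambda>(f, x). f x)"
    using L by (auto simp: lie_subgroup_of_isometries_def lie_group_def)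
  obtain k where biinv: "bi_invariant_metric ?K L k"
    and sub: "riemannian_submersion L k M g (\<lambda>f. f p)"
    using norm by (auto simp: normal_homogeneous_space_def)
  have k: "riemannian_metric L k" using biinv by (simp add: bi_invariant_metric_def)
  let ?\<pi> = "\<lambda>f::'a \<Rightarrow> 'a. f p"
  have \<pi>: "differentiable_map L M ?\<pi>"
    using sub by (simp add: riemannian_submersion_def smooth_map_imp_differentiable_map)

  \<comment> \<open>Base point, charts and lifted tangent vectors\<close>
  define q where "q = chart_inv c x"
  have q: "q \<in> fst c" "snd c q = x" "q \<in> points M" "c \<in> charts_at M q"
    using chart_apply_inv[OF x] smooth_manifoldD(2)[OF M c] c by (auto simp: q_def charts_at_def)
  obtain a where a: "a \<in> points L" "a p = q"
    using norm p q(3) transitive_action.unique_orbit[of ?K "points M" "\<lambda>f. f" p q] carrier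
    unfolding normal_homogeneous_space_def by auto
  define e1 where "e1 = \<one>\<^bsub>?K\<^esub>"
  have e1: "e1 \<in> points L" using K carrier by (metis e1_def group.is_monoid monoid.one_closed)
  have ae1: "a \<otimes>\<^bsub>?K\<^esub> e1 = a" using K carrier a by (metis e1_def group.is_monoid monoid.r_one)
  have e1p: "e1 p = p"
  proof -
    \<comment> \<open>That the identity fixes \<open>p\<close> follows by cancelling the injective
      map \<open>a\<close>.\<close>
    have "a (e1 p) = a p" using subgroup_of_isometriesD(3)[OF L a(1) e1 p] ae1 by simp
    moreover have "e1 p \<in> points M" using differentiable_map_in_points[OF \<pi> e1] .
    ultimately show ?thesis
      using subgroup_of_isometriesD(2)[OF L a(1)] p by (auto simp: bij_betw_def inj_on_def)
  qed
  \<comment> \<open>Charts are fixed at four points: \<open>d\<close> at \<open>a\<close>,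
    \<open>e\<close> at the identity, \<open>c0\<close> at \<open>p\<close>, and the given
    \<open>c\<close> at \<open>q\<close>.\<close>
  obtain d where d: "d \<in> charts_at L a" using smooth_manifoldD(3)[OF LM a(1)] by blast
  obtain e where e: "e \<in> charts_at L e1" using smooth_manifoldD(3)[OF LM e1] by blast
  obtain c0 where c0: "c0 \<in> charts_at M p" using smooth_manifoldD(3)[OF M p] by blast
  have chd: "is_chart (mtop L) d" "a \<in> fst d" "d \<in> atlas L"
    and che: "is_chart (mtop L) e" "e1 \<in> fst e" "e \<in> atlas L"
    and chc0: "is_chart (mtop M) c0" "p \<in> fst c0" "c0 \<in> atlas M"
    and chc: "is_chart (mtop M) c"
    using d e c0 c smooth_manifoldD(1)[OF LM] smooth_manifoldD(1)[OF M] by (auto simp: charts_at_def)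
  \<comment> \<open>Horizontality of this lift will give equality of lengths at
    \<open>t = 0\<close>.\<close>
  obtain \<eta> where \<eta>: "\<eta> \<in> horizontal_space L k M ?\<pi> a"
    and D\<eta>: "differential L M ?\<pi> a \<eta> = coord_vec M c q u"
  proof -
    have "coord_vec M c q u \<in> differential L M ?\<pi> a ` horizontal_space L k M ?\<pi> a"
      using sub a coord_vec_in_tangent_space[OF M q(4)]
      by (auto simp: riemannian_submersion_def bij_betw_def)
    then show ?thesis using that by fastforce
  qed
  have \<eta>T: "\<eta> \<in> tangent_space L a" using \<eta> by (simp add: horizontal_space_def)
  \<comment> \<open>This is the initial velocity of the curve \<open>?\<gamma>\<close>
    below.\<close>
  obtain \<xi> where \<xi>T: "\<xi> \<in> tangent_space L e1" and D\<xi>: "differential L M ?\<pi> e1 \<xi> = X p"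
  proof -
    have "X p \<in> tangent_space M (e1 p)" using X p e1p by (simp add: smooth_vector_field_def)
    then have "X p \<in> differential L M ?\<pi> e1 ` horizontal_space L k M ?\<pi> e1"
      using sub e1 by (auto simp: riemannian_submersion_def bij_betw_def)
    then show ?thesis using that by (fastforce simp: horizontal_space_def)
  qed

  \<comment> \<open>\<open>E\<close> is the evaluation \<open>L \<times> M \<rightarrow> M\<close> in coordinates, defined on \<open>S\<close>.\<close>
  let ?ev = "\<lambda>(f::'a \<Rightarrow> 'a, x). f x"
  define B where "B = (fst d \<times> fst c0, map_prod (snd d) (snd c0))"
  have B: "B \<in> atlas (prod_mfd L M)" "is_chart (prod_topology (mtop L) (mtop M)) B"
    unfolding B_def by (rule prod_chart_in_atlas[OF chd(3) chc0(3)], rule is_chart_prod[OF chd(1) chc0(1)])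
  define E where "E = snd c \<circ> ?ev \<circ> chart_inv B"
  define S where "S = snd B ` {z \<in> fst B. ?ev z \<in> fst c}"
  have SE: "smooth_on S E" using eval B(1) c unfolding smooth_map_def S_def E_def by blast
  have "open S" unfolding S_def
    using eval by (intro open_coordinate_domain[OF B(2) _ chc]) (simp add: smooth_map_def prod_mfd_def)
  define y0 where "y0 = snd d a"
  define z0 where "z0 = snd c0 p"
  have inS: "(snd d f, snd c0 z) \<in> S" if "f \<in> fst d" "z \<in> fst c0" "f z \<in> fst c" for f z
    using that unfolding S_def B_def by (force intro!: image_eqI[of _ _ "(f, z)"])
  have E_apply: "E (snd d f, snd c0 z) = snd c (f z)" if "f \<in> fst d" "z \<in> fst c0" for f z
    using that chart_inv_prod[OF chd(1) chc0(1), of "snd d f" "snd c0 z"] chd(1) chc0(1)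
    by (simp add: E_def B_def chart_image_def)
  have S0: "(y0, z0) \<in> S" unfolding y0_def z0_def using inS chd chc0 a(2) q by simp
  let ?DE = "\<lambda>w y. frechet_derivative E (at y) w"
  have DE: "(E has_derivative frechet_derivative E (at y)) (at y)" if "y \<in> S" for y
    using smooth_on_imp_differentiable[OF SE that] by (simp add: frechet_derivative_works)
  have D2E: "(?DE w has_derivative frechet_derivative (?DE w) (at y)) (at y)" if "y \<in> S" for y w
    using smooth_on_imp_derivative_differentiable[OF SE that] by (simp add: frechet_derivative_works)

  \<comment> \<open>The first partial derivative of \<open>E\<close> differentiates the group
    element at a fixed point of the manifold; the second, in \<open>slice'\<close>, differentiates a
    fixed group element as a map of the manifold.\<close>
  have slice: "((\<lambda>y. snd c (chart_inv d y z)) has_derivative (\<lambda>h. ?DE (h, 0) (snd d f, snd c0 z))) (at (snd d f))"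
    if "f \<in> fst d" "z \<in> fst c0" "f z \<in> fst c" for f z
    using coordinate_slice_fst[OF chd(1) chc0(1) that(1,2), of "snd c \<circ> ?ev"] DE[OF inS[OF that]]
    by (simp add: E_def B_def o_def)
  have slice': "((\<lambda>y. snd c (f (chart_inv c0 y))) has_derivative (\<lambda>h. ?DE (0, h) (snd d f, snd c0 z))) (at (snd c0 z))"
    if "f \<in> fst d" "z \<in> fst c0" "f z \<in> fst c" for f z
    using coordinate_slice_snd[OF chd(1) chc0(1) that(1,2), of "snd c \<circ> ?ev"] DE[OF inS[OF that]]
    by (simp add: E_def B_def o_def)

  have u: "?DE (\<eta> d, 0) (y0, z0) = u"
  proof -
    have "u = frechet_derivative (snd c \<circ> ?\<pi> \<circ> chart_inv d) (at y0) (\<eta> d)"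
      using differential_apply[OF LM \<pi> \<eta>T d, of c] coord_vec_self[OF M q(4), of u] D\<eta> a(2) q(4)
      by (simp add: y0_def)
    then show ?thesis
      using fun_cong[OF frechet_derivative_at[OF slice[OF chd(2) chc0(2)]], of "\<eta> d"] a(2) q(1)
      by (simp add: y0_def z0_def o_def)
  qed

  \<comment> \<open>The tangent vector on the left is the image under the submersion of a right translate of \<open>\<eta>\<close>.\<close>
  have norm_le: "metric_in_chart M g c (E (y0, z)) (?DE (\<eta> d, 0) (y0, z)) (?DE (\<eta> d, 0) (y0, z)) \<le> k a \<eta> \<eta>"
    if b: "b \<in> points L" "b p \<in> fst c0" "a (b p) \<in> fst c" and z: "z = snd c0 (b p)" for b z
  proof -
    let ?R = "\<lambda>f. f \<otimes>\<^bsub>?K\<^esub> b"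
    have Rb: "differentiable_map L L ?R"
      using differentiable_map_slice[OF LM LM mult b(1)] by simp
    let ?\<zeta> = "differential L L ?R a \<eta>"
    have bM: "b p \<in> points M" using differentiable_map_in_points[OF \<pi> b(1)] .
    have Ra: "?R a \<in> points L" using differentiable_map_in_points[OF Rb a(1)] .
    have \<pi>R: "?\<pi> (?R f) = f (b p)" if "f \<in> points L" for f
      by (rule subgroup_of_isometriesD(3)[OF L that b(1) p])
    have \<zeta>T: "?\<zeta> \<in> tangent_space L (?R a)"
      by (rule differential_in_tangent_space[OF LM LM Rb \<eta>T a(1)])
    obtain d' where d': "d' \<in> charts_at L (?R a)" using smooth_manifoldD(3)[OF LM Ra] by blast
    have c': "c \<in> charts_at M (?\<pi> (?R a))" using c b \<pi>R[OF a(1)] by (simp add: charts_at_def)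
    define T where "T = differential L M ?\<pi> (?R a) ?\<zeta>"
    have TT: "T \<in> tangent_space M (?\<pi> (?R a))"
      unfolding T_def by (rule differential_in_tangent_space[OF LM M \<pi> \<zeta>T Ra])
    \<comment> \<open>Submersion after right translation by \<open>b\<close> is evaluation at
      \<open>b p\<close>, so the chain rule identifies the image of the translated vector with a
      partial derivative of \<open>E\<close>.\<close>
    have "T c = frechet_derivative (snd c \<circ> (?\<pi> \<circ> ?R) \<circ> chart_inv d) (at y0) (\<eta> d)"
      unfolding T_def differential_apply[where f = ?\<pi> and x = "?R a", OF LM \<pi> \<zeta>T d' c'] differential_apply[where f = ?R and x = a, OF LM Rb \<eta>T d d'] y0_def
      by (rule frechet_coordinate_chain_rule[where f = ?R and h = ?\<pi> and x = a, OF LM LM Rb \<pi> d d' c', symmetric])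
    also have "\<dots> = ?DE (\<eta> d, 0) (y0, z)"
    proof -
      have "((snd c \<circ> (?\<pi> \<circ> ?R) \<circ> chart_inv d) has_derivative (\<lambda>h. ?DE (h, 0) (y0, z))) (at y0)"
        unfolding y0_def z
      proof (rule has_derivative_transform_within_open[OF slice[OF chd(2) b(2,3)]])
        show "open (chart_image d)" "snd d a \<in> chart_image d"
          using chd by (auto simp: is_chart_def chart_image_def)
        show "snd c (chart_inv d y (b p)) = (snd c \<circ> (?\<pi> \<circ> ?R) \<circ> chart_inv d) y" if "y \<in> chart_image d" for y
          using \<pi>R smooth_manifoldD(2)[OF LM chd(3) chart_apply_inv(2)[OF that]] by simp
      qed
      from fun_cong[OF frechet_derivative_at[OF this], of "\<eta> d"] show ?thesis by simp
    qed
    finally have Tc: "T c = ?DE (\<eta> d, 0) (y0, z)" .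
    have Ez: "E (y0, z) = snd c (a (b p))"
      unfolding y0_def z by (rule E_apply[OF chd(2) b(2)])
    have "metric_in_chart M g c (E (y0, z)) (T c) (T c) = g (?\<pi> (?R a)) T T"
      unfolding metric_in_chart_def Let_def Ez chart_inv_apply[OF chc b(3)]
      using coord_vec_of_tangent[OF TT c'] \<pi>R[OF a(1)] by simp
    \<comment> \<open>The right translate \<open>?\<zeta>\<close> need not be horizontal, so only an
      inequality results.\<close>
    also have "\<dots> \<le> k (?R a) ?\<zeta> ?\<zeta>"
      unfolding T_def by (rule riemannian_submersion_norm_le[OF LM M k sub Ra \<zeta>T])
    also have "\<dots> = k a \<eta> \<eta>"
      using biinv b(1) a(1) \<eta>T carrier by (simp add: bi_invariant_metric_def preserves_metric_def)
    finally show ?thesis unfolding Tc .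
  qed

  \<comment> \<open>Invariance of the field in coordinates\<close>
  let ?X = "\<lambda>y. X (chart_inv c y) c"
  \<comment> \<open>By invariance, \<open>X\<close> at \<open>f p\<close> is the image of
    \<open>X p\<close> under the differential of \<open>f\<close>, that is, a partial derivative of
    \<open>E\<close> in the manifold variable.\<close>
  have X_E: "?X (E (snd d f, z0)) = ?DE (0, X p c0) (snd d f, z0)" if f: "f \<in> fst d" "f p \<in> fst c" for f
  proof -
    have fL: "f \<in> points L" by (rule smooth_manifoldD(2)[OF LM chd(3) f(1)])
    have "X (f p) c = differential M M f p (X p) c"
      using invariant_vector_field_differential[OF inv fL subgroup_of_isometriesD(2)[OF L fL] p] by simp
    also have "\<dots> = frechet_derivative (snd c \<circ> f \<circ> chart_inv c0) (at z0) (X p c0)"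
      unfolding z0_def
      using X p c f c0
      by (intro differential_apply[OF M smooth_map_imp_differentiable_map[OF subgroup_of_isometriesD(1)[OF L fL]]])
         (auto simp: smooth_vector_field_def charts_at_def)
    also have "\<dots> = ?DE (0, X p c0) (snd d f, z0)"
      using fun_cong[OF frechet_derivative_at[OF slice'[OF f(1) chc0(2) f(2)]], of "X p c0"]
      by (simp add: z0_def o_def)
    finally show ?thesis
      using E_apply[OF f(1) chc0(2)] chart_inv_apply[OF chc f(2)] by (simp add: z0_def)
  qed
  have E0: "E (y0, z0) = x" using E_apply[OF chd(2) chc0(2)] a(2) q by (simp add: y0_def z0_def)
  have Xx: "?X x = ?DE (0, X p c0) (y0, z0)"
    using X_E[OF chd(2)] a(2) q E0 by (simp add: y0_def)

  \<comment> \<open>Differentiating \<open>X_E\<close> in the group variable along \<eta> gives the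
    derivative of the field along \<open>u\<close> on one side and a mixed second derivative of
    \<open>E\<close> on the other; then the order of differentiation is exchanged.\<close>
  have DX: "frechet_derivative ?X (at x) u = frechet_derivative (?DE (\<eta> d, 0)) (at (y0, z0)) (0, X p c0)"
  proof -
    have dX: "(?X has_derivative frechet_derivative ?X (at x)) (at x)"
      using X c x by (auto simp: smooth_vector_field_def simp flip: frechet_derivative_works
          intro: smooth_on_imp_differentiable)
    have in1: "((\<lambda>y. (y, z0)) has_derivative (\<lambda>h. (h, 0))) (at y0)"
      by (auto intro!: derivative_eq_intros)
    have 1: "((\<lambda>y. ?X (E (y, z0))) has_derivative (\<lambda>h. frechet_derivative ?X (at x) (?DE (h, 0) (y0, z0)))) (at y0)"
      by (rule has_derivative_compose[OF has_derivative_compose[OF in1 DE[OF S0]]]) (use dX E0 in simp)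
    have 2: "((\<lambda>y. ?DE (0, X p c0) (y, z0)) has_derivative
        (\<lambda>h. frechet_derivative (?DE (0, X p c0)) (at (y0, z0)) (h, 0))) (at y0)"
      by (rule has_derivative_compose[OF in1 D2E[OF S0]])
    have "((\<lambda>y. ?X (E (y, z0))) has_derivative
        (\<lambda>h. frechet_derivative (?DE (0, X p c0)) (at (y0, z0)) (h, 0))) (at y0)"
    proof (rule has_derivative_transform_within_open[OF 2])
      show "open (snd d ` {f \<in> fst d. ?\<pi> f \<in> fst c})"
        using \<pi> by (intro open_coordinate_domain[OF chd(1) _ chc]) (simp add: differentiable_map_def)
      show "y0 \<in> snd d ` {f \<in> fst d. ?\<pi> f \<in> fst c}"
        using chd a q by (auto simp: y0_def)
    qed (use X_E in auto)
    from has_derivative_unique[OF this 1]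
    have "frechet_derivative ?X (at x) (?DE (\<eta> d, 0) (y0, z0)) =
        frechet_derivative (?DE (0, X p c0)) (at (y0, z0)) (\<eta> d, 0)" by metis
    also have "\<dots> = frechet_derivative (?DE (\<eta> d, 0)) (at (y0, z0)) (0, X p c0)"
      using SE by (intro symmetric_second_derivative[OF \<open>open S\<close> S0]) (simp add: smooth_on_def)
    finally show ?thesis unfolding u .
  qed

  \<comment> \<open>The curve through the identity and the maximum argument\<close>
  let ?\<gamma> = "\<lambda>t. chart_inv e (snd e e1 + t *\<^sub>R \<xi> e)"
  \<comment> \<open>The coordinates in \<open>c0\<close> of the point \<open>?\<gamma> t p\<close>,
    where \<open>?\<gamma>\<close> is a straight line in the chart \<open>e\<close>.\<close>
  define m where "m = (\<lambda>t. (snd c0 \<circ> ?\<pi> \<circ> chart_inv e) (snd e e1 + t *\<^sub>R \<xi> e))"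
  have m0: "m 0 = z0" using chart_inv_apply[OF che(1,2)] e1p by (simp add: m_def z0_def)
  have c0e: "c0 \<in> charts_at M (?\<pi> e1)" using c0 e1p by simp
  have dm: "(m has_vector_derivative X p c0) (at 0)"
  proof -
    have "X p c0 = frechet_derivative (snd c0 \<circ> ?\<pi> \<circ> chart_inv e) (at (snd e e1)) (\<xi> e)"
      using differential_apply[where f = ?\<pi> and x = e1, OF LM \<pi> \<xi>T e c0e] D\<xi> by simp
    moreover have "(snd c0 \<circ> ?\<pi> \<circ> chart_inv e) differentiable (at (snd e e1 + 0 *\<^sub>R \<xi> e))"
      using differentiable_mapD[where f = ?\<pi> and x = e1, OF \<pi> e c0e] by (auto simp: differentiable_def)
    from has_vector_derivative_along_line[OF this] calculation show ?thesis
      unfolding m_def by simp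
  qed

  let ?G = "\<lambda>(y, u, v). metric_in_chart M g c y u v"
  \<comment> \<open>Unlike the two-parameter map in the sketch, \<open>\<Phi>\<close> is the squared
    length of the partial derivative of \<open>E\<close> along \<eta>, as a function of the manifold
    coordinate.\<close>
  define \<Phi> where "\<Phi> = (\<lambda>z. ?G (E (y0, z), ?DE (\<eta> d, 0) (y0, z), ?DE (\<eta> d, 0) (y0, z)))"
  let ?D\<Phi> = "\<lambda>h. frechet_derivative ?G (at (x, u, u)) (?DE (0, h) (y0, z0),
    frechet_derivative (?DE (\<eta> d, 0)) (at (y0, z0)) (0, h),
    frechet_derivative (?DE (\<eta> d, 0)) (at (y0, z0)) (0, h))"
  have d\<Phi>: "(\<Phi> has_derivative ?D\<Phi>) (at z0)"
  proof -
    have in2: "((\<lambda>z. (y0, z)) has_derivative (\<lambda>h. (0, h))) (at z0)"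
      by (auto intro!: derivative_eq_intros)
    have 1: "((\<lambda>z. (E (y0, z), ?DE (\<eta> d, 0) (y0, z), ?DE (\<eta> d, 0) (y0, z))) has_derivative
       (\<lambda>h. (?DE (0, h) (y0, z0), frechet_derivative (?DE (\<eta> d, 0)) (at (y0, z0)) (0, h),
          frechet_derivative (?DE (\<eta> d, 0)) (at (y0, z0)) (0, h)))) (at z0)"
      by (intro has_derivative_Pair has_derivative_compose[OF in2 DE[OF S0]]
          has_derivative_compose[OF in2 D2E[OF S0]])
    show ?thesis unfolding \<Phi>_def
      by (rule has_derivative_compose[OF 1])
         (use metric_in_chart_differentiable[OF R c x, of u u] in \<open>simp add: E0 u frechet_derivative_works\<close>)
  qed
  have d\<Phi>m: "((\<lambda>t. \<Phi> (m t)) has_derivative (\<lambda>h. ?D\<Phi> (h *\<^sub>R X p c0))) (at 0)"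
    by (rule has_derivative_compose[OF dm[unfolded has_vector_derivative_def]]) (use d\<Phi> m0 in simp)

  \<comment> \<open>The line leaves the chart image in general. On the preimage \<open>T\<close> of
    \<open>W\<close>, an open neighbourhood of 0, \<open>?\<gamma> t\<close> is a point of the chart
    domain, with \<open>?\<gamma> t p\<close> in the domain of \<open>c0\<close> and
    \<open>a (?\<gamma> t p)\<close> in that of \<open>c\<close>.\<close>
  define W where "W = snd e ` {f \<in> fst e. ?\<pi> f \<in> fst c0} \<inter> snd e ` {f \<in> fst e. (a \<circ> ?\<pi>) f \<in> fst c}"
  have "open W"
  proof -
    have \<pi>c: "continuous_map (mtop L) (mtop M) ?\<pi>" and "continuous_map (mtop M) (mtop M) a"
      using \<pi> subgroup_of_isometriesD(1)[OF L a(1)] by (auto simp: differentiable_map_def smooth_map_def)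
    then have "continuous_map (mtop L) (mtop M) (a \<circ> ?\<pi>)" by (rule continuous_map_compose)
    with \<pi>c show ?thesis unfolding W_def
      by (intro open_Int open_coordinate_domain[OF che(1) _ chc] open_coordinate_domain[OF che(1) _ chc0(1)])
  qed
  define T where "T = (\<lambda>t. snd e e1 + t *\<^sub>R \<xi> e) -` W"
  have "open T" unfolding T_def
    by (intro open_vimage \<open>open W\<close> continuous_intros)
  have "0 \<in> T"
    using che(2) chc0(2) e1p a(2) q(1) by (auto simp: T_def W_def)
  have max: "\<Phi> (m t) \<le> \<Phi> (m 0)" if "t \<in> T" for t
  proof -
    have "snd e e1 + t *\<^sub>R \<xi> e \<in> W" using that by (simp add: T_def)
    \<comment> \<open>The two images defining \<open>W\<close> supply two witnesses; both equal
      \<open>?\<gamma> t\<close>.\<close>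
    then obtain f f' where "f \<in> fst e" "snd e e1 + t *\<^sub>R \<xi> e = snd e f" "f p \<in> fst c0"
      and "f' \<in> fst e" "snd e e1 + t *\<^sub>R \<xi> e = snd e f'" "a (f' p) \<in> fst c"
      unfolding W_def by auto
    moreover from this have "?\<gamma> t = f" "?\<gamma> t = f'"
      using chart_inv_apply[OF che(1)] by metis+
    ultimately have "?\<gamma> t \<in> fst e" "?\<gamma> t p \<in> fst c0" "a (?\<gamma> t p) \<in> fst c"
      by simp_all
    moreover from this have "?\<gamma> t \<in> points L" using smooth_manifoldD(2)[OF LM che(3)] by blast
    ultimately have "\<Phi> (m t) \<le> k a \<eta> \<eta>"
      unfolding \<Phi>_def prod.case by (intro norm_le) (simp_all add: m_def)
    \<comment> \<open>Here horizontality of \<eta> turns the upper bound into the value at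
      0.\<close>
    also have "k a \<eta> \<eta> = g (?\<pi> a) (differential L M ?\<pi> a \<eta>) (differential L M ?\<pi> a \<eta>)"
      by (rule riemannian_submersion_isometric[where f = ?\<pi> and x = a, OF sub a(1) \<eta> \<eta>, symmetric])
    also have "\<dots> = g q (coord_vec M c q u) (coord_vec M c q u)"
      unfolding D\<eta> a(2) ..
    also have "\<dots> = \<Phi> (m 0)"
      unfolding m0 \<Phi>_def prod.case E0 u metric_in_chart_def Let_def q_def ..
    finally show ?thesis .
  qed
  have "(\<lambda>h. ?D\<Phi> (h *\<^sub>R X p c0)) = (\<lambda>h. 0)"
    by (rule differential_zero_maxmin[OF \<open>0 \<in> T\<close> \<open>open T\<close> d\<Phi>m]) (intro disjI1 ballI max)
  from fun_cong[OF this, of 1] have "?D\<Phi> (X p c0) = 0" unfolding scaleR_one .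
  \<comment> \<open>With \<open>Xx\<close> and \<open>DX\<close> the vanishing derivative at the
    maximum becomes the total derivative of the metric that
    \<open>metric_in_chart_derivative\<close> expands into the Lie derivative.\<close>
  then have "frechet_derivative ?G (at (x, u, u)) (?X x, frechet_derivative ?X (at x) u, frechet_derivative ?X (at x) u) = 0"
    unfolding DX Xx .
  then show ?thesis
    unfolding metric_in_chart_derivative[OF R c x] by (simp add: lie_derivative_metric_def Let_def)
qed

theorem corollary3p4:
  fixes M :: "('m, 'e::real_normed_vector) mfd"
    and g :: "('m, 'e) metric"
    and L :: "('m \<Rightarrow> 'm, 'f::real_normed_vector) mfd"
    and H :: "('m \<Rightarrow> 'm) set"
    and p :: 'm
    and X :: "'m \<Rightarrow> ('m, 'e) tvec"
  assumes "normal_homogeneous_space M g L H p"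
    and "compact_space (mtop M)"
    and "smooth_vector_field M X"
    and "invariant_vector_field M (points L) X"
  shows "killing_field M g X"
proof (rule killing_field_diagonalI)
  show "riemannian_manifold M g" using assms(1) unfolding normal_homogeneous_space_def by blast
qed (rule assms(3), rule lie_derivative_metric_diagonal[OF assms(1,3,4)])

end
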